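(* Let $R$ and $B$ be two independent random $n$-element submultisets of the leaves of a balanced HST $H(b,\delta,\lambda)$, with $b$ and $\lambda$ fixed, and let $h=\min(\delta,\log_b n)$. Then the expected cost of the optimal bichromatic tour on $R$ and $B$ is \[\Theta\Big(\sqrt{n}\cdot\sum_{i=1}^{h}(\sqrt{b}\,\lambda)^i\Big).\]
   Context: A balanced HST $H(b,\delta,\lambda)$ (integers $b\ge2$, $\delta\ge1$, real $0<\lambda<1$) is a rooted tree in which every non-leaf vertex has exactly $b$ children and every leaf is at depth $\delta$; the root is at level $0$, and each edge joining a vertex at level $\ell-1$ to a child at level $\ell$ has weight $\lambda^\ell$. The distance $d_H(x,y)$ is the total weight of the tree path between $x$ and $y$. A random $n$-element submultiset of the leaves is obtained by choosing $n$ leaves independently and uniformly at random (repetitions allowed); copies of the same leaf are treated as distinct points at distance $0$. A bichromatic tour is a Hamiltonian cycle on $R\cup B$ in which every edge joins a red point (of $R$) and a blue point (of $B$); its cost is the sum of $d_H$ over its edges, and the optimal bichromatic tour is one of minimum cost. The sum ranges over integers $i$ with $1\le i\le h$; the implied constants depend only on $b$ and $\lambda$. *)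

theory Defs
  imports "HOL-Probability.Probability"
begin

text \<open>
  The balanced HST with branching factor \<open>b\<close> and depth \<open>\<delta>\<close>. A vertex is the word of child indices
  on its path from the root, so its level is its length and the children of \<open>v\<close> are the words
  \<open>v @ [i]\<close> with \<open>i < b\<close>.
\<close>

definition hst_vertices :: "nat \<Rightarrow> nat \<Rightarrow> nat list set" where
  "hst_vertices b \<delta> = {v. set v \<subseteq> {..<b} \<and> length v \<le> \<delta>}"

definition hst_leaves :: "nat \<Rightarrow> nat \<Rightarrow> nat list set" where
  "hst_leaves b \<delta> = {v \<in> hst_vertices b \<delta>. length v = \<delta>}"

definition hst_adjacent :: "nat list \<Rightarrow> nat list \<Rightarrow> bool" where
  "hst_adjacent u v \<longleftrightarrow> (\<exists>i. v = u @ [i]) \<or> (\<exists>i. u = v @ [i])"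

definition hst_edge_weight :: "real \<Rightarrow> nat list \<Rightarrow> nat list \<Rightarrow> real" where
  "hst_edge_weight lam u v = lam ^ max (length u) (length v)"

definition hst_path :: "nat \<Rightarrow> nat \<Rightarrow> nat list \<Rightarrow> nat list \<Rightarrow> nat list list \<Rightarrow> bool" where
  "hst_path b \<delta> x y p \<longleftrightarrow>
     p \<noteq> [] \<and> hd p = x \<and> last p = y \<and> set p \<subseteq> hst_vertices b \<delta> \<and>
     distinct p \<and> successively hst_adjacent p"

definition hst_path_weight :: "real \<Rightarrow> nat list list \<Rightarrow> real" where
  "hst_path_weight lam p = (\<Sum>(u, v) \<leftarrow> zip p (tl p). hst_edge_weight lam u v)"

definition hst_dist :: "nat \<Rightarrow> nat \<Rightarrow> real \<Rightarrow> nat list \<Rightarrow> nat list \<Rightarrow> real" where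
  "hst_dist b \<delta> lam x y = hst_path_weight lam (THE p. hst_path b \<delta> x y p)"

text \<open>
  A random \<open>n\<close>-element submultiset of the leaves is a random family of leaves indexed by \<open>{..<n}\<close>,
  so that copies of the same leaf remain distinct points.
\<close>

definition random_leaves :: "nat \<Rightarrow> nat \<Rightarrow> nat \<Rightarrow> (nat \<Rightarrow> nat list) pmf" where
  "random_leaves b \<delta> n = Pi_pmf {..<n} [] (\<lambda>_. pmf_of_set (hst_leaves b \<delta>))"

text \<open>
  The points are \<open>Inl i\<close> (red, located at \<open>R i\<close>) and \<open>Inr j\<close> (blue, located at \<open>B j\<close>) for
  \<open>i, j < n\<close>. A tour is the list of all points in cyclic order; for \<open>n = 1\<close> it degenerates to
  the closed walk that uses the only red-blue pair twice.
\<close>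

definition cycle_edges :: "'a list \<Rightarrow> ('a \<times> 'a) list" where
  "cycle_edges p = zip p (rotate1 p)"

definition bichromatic_tour :: "nat \<Rightarrow> (nat + nat) list \<Rightarrow> bool" where
  "bichromatic_tour n p \<longleftrightarrow>
     distinct p \<and> set p = {..<n} <+> {..<n} \<and>
     (\<forall>(u, v) \<in> set (cycle_edges p). isl u \<noteq> isl v)"

definition tour_cost ::
  "nat \<Rightarrow> nat \<Rightarrow> real \<Rightarrow> (nat \<Rightarrow> nat list) \<Rightarrow> (nat \<Rightarrow> nat list) \<Rightarrow> (nat + nat) list \<Rightarrow> real" where
  "tour_cost b \<delta> lam R B p =
     (\<Sum>(u, v) \<leftarrow> cycle_edges p. hst_dist b \<delta> lam (case_sum R B u) (case_sum R B v))"

definition opt_tour_cost ::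
  "nat \<Rightarrow> nat \<Rightarrow> real \<Rightarrow> nat \<Rightarrow> (nat \<Rightarrow> nat list) \<Rightarrow> (nat \<Rightarrow> nat list) \<Rightarrow> real" where
  "opt_tour_cost b \<delta> lam n R B = Min (tour_cost b \<delta> lam R B ` {p. bichromatic_tour n p})"

definition expected_opt_tour_cost :: "nat \<Rightarrow> nat \<Rightarrow> real \<Rightarrow> nat \<Rightarrow> real" where
  "expected_opt_tour_cost b \<delta> lam n =
     measure_pmf.expectation (pair_pmf (random_leaves b \<delta> n) (random_leaves b \<delta> n))
       (\<lambda>(R, B). opt_tour_cost b \<delta> lam n R B)"

end

theory Submission
  imports Defs "HOL-Library.Sublist" "HOL-Library.Multiset"
begin

text \<open>
  Two leaves are at distance \<open>2 * (\<Sum>i. lam ^ i)\<close>, summed over the levels \<open>i\<close> at which their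
  ancestors differ, so a tour costs \<open>2 * (\<Sum>i. lam ^ i * N i)\<close>, where \<open>N i\<close> counts its edges between
  different subtrees of level \<open>i\<close>. Since a tour alternates colours, \<open>N i\<close> is at least the sum over the
  vertices \<open>v\<close> of level \<open>i\<close> of the imbalance \<open>D v\<close>, the absolute difference of the numbers of red and
  blue points below \<open>v\<close>. Conversely, joining alternating paths greedily from the leaves upwards leaves
  at most \<open>max 1 (D v)\<close> paths below each nonempty \<open>v\<close>, and the resulting tour attains
  \<open>N i \<le> (\<Sum>v. max 1 (D v))\<close> at all levels simultaneously. The signed imbalance is an \<open>n\<close>-step walk
  with variance \<open>2 * n * p * (1 - p)\<close> for \<open>p = 1 / b ^ i\<close>; its second and fourth moments show that
  \<open>D v\<close> has expectation of order \<open>sqrt (n / b ^ i)\<close> as long as \<open>b ^ i \<le> n\<close>. On deeper levels the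
  trivial bound \<open>N i \<le> 2 * n\<close> yields a geometric tail dominated by the last shallow level.
\<close>

section \<open>Distances in the tree\<close>

lemma hst_path_Cons_Cons:
  "hst_path b \<delta> x y (u # v # p) \<longleftrightarrow>
     u = x \<and> u \<in> hst_vertices b \<delta> \<and> u \<notin> set (v # p) \<and> hst_adjacent u v \<and> hst_path b \<delta> v y (v # p)"
  by (auto simp: hst_path_def)

text \<open>The subtree below \<open>x @ [i]\<close> is joined to the rest of the tree only by the
  edge to its parent \<open>x\<close>, which the walk avoids.\<close>

lemma walk_avoiding_stays_in_subtree:
  assumes "successively hst_adjacent p" "p \<noteq> []" "prefix (x @ [i]) (hd p)" "x \<notin> set p"
  shows "\<forall>w \<in> set p. prefix (x @ [i]) w"
  using assms
proof (induction p rule: induct_list012)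
  case (3 u v p)
  have "prefix (x @ [i]) v"
    using 3(3,5,6) by (auto simp: hst_adjacent_def)
  with 3(2-6) show ?case by simp
qed auto

text \<open>Dually, the subtree rooted at \<open>x\<close> can be entered from outside only at
  \<open>x\<close> itself.\<close>

lemma walk_avoiding_stays_outside_subtree:
  assumes "successively hst_adjacent p" "p \<noteq> []" "\<not> prefix x (hd p)" "x \<notin> set p"
  shows "\<forall>w \<in> set p. \<not> prefix x w"
  using assms
proof (induction p rule: induct_list012)
  case (3 u v p)
  have "\<not> prefix x v"
    using 3(3,5,6) by (auto simp: hst_adjacent_def)
  with 3(2-6) show ?case by simp
qed auto

text \<open>A simple path never returns to \<open>x\<close>, so its first step must already enter
  the component of the tree without \<open>x\<close> that contains \<open>y\<close>. The endpoints
  therefore determine the second vertex.\<close>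

lemma hst_path_second_vertex:
  assumes "hst_path b \<delta> x y (x # v # p)"
  shows "v = (if prefix x y then take (Suc (length x)) y else butlast x)"
proof -
  have p: "successively hst_adjacent (v # p)" "x \<notin> set (v # p)" "y \<in> set (v # p)" "hst_adjacent x v"
    using assms last_in_set[of "v # p"] by (auto simp: hst_path_def)
  consider i where "v = x @ [i]" | i where "x = v @ [i]"
    using p(4) by (auto simp: hst_adjacent_def)
  then show ?thesis
  proof cases
    case 1
    then have "prefix (x @ [i]) y"
      using walk_avoiding_stays_in_subtree[OF p(1), of x i] p(2,3) by auto
    with 1 show ?thesis by (auto simp: prefix_def)
  next
    case 2
    then have "\<not> prefix x y"
      using walk_avoiding_stays_outside_subtree[OF p(1), of x] p(2,3) by auto
    with 2 show ?thesis by auto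
  qed
qed

text \<open>This gives the \<open>THE\<close> in \<open>hst_dist\<close> its meaning. Both paths
  take the same forced first step, and induction applies to the remainders.\<close>

lemma hst_path_unique:
  assumes "hst_path b \<delta> x y p" "hst_path b \<delta> x y q"
  shows "p = q"
  using assms
proof (induction p arbitrary: x q)
  case Nil
  then show ?case by (simp add: hst_path_def)
next
  case (Cons a p)
  have [simp]: "a = x" using Cons.prems by (simp add: hst_path_def)
  obtain q' where q: "q = x # q'"
    using Cons.prems(2) by (cases q) (auto simp: hst_path_def)
  show ?case
  proof (cases "x = y")
    case True
    have "r = []" if "hst_path b \<delta> x y (x # r)" for r
      using that True last_in_set[of r] by (auto simp: hst_path_def split: if_splits)
    with Cons.prems q show ?thesis by auto
  next
    case False
    then obtain v p' w q'' where *: "p = v # p'" "q' = w # q''"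
      using Cons.prems q by (cases p; cases q') (auto simp: hst_path_def)
    have "v = w"
      using hst_path_second_vertex[of b \<delta> x y v p'] hst_path_second_vertex[of b \<delta> x y w q'']
        Cons.prems q * by simp
    then show ?thesis
      using Cons.IH[of v q'] Cons.prems q * by (auto simp: hst_path_Cons_Cons)
  qed
qed

text \<open>The location of the path between \<open>l\<close> and \<open>l @ ys\<close> is carried
  through the induction because it shows that a newly prepended ancestor is not yet on the
  path.\<close>

lemma hst_path_downward:
  assumes "l @ ys \<in> hst_vertices b \<delta>"
  shows "\<exists>p. hst_path b \<delta> l (l @ ys) p \<and> (\<forall>w \<in> set p. prefix l w \<and> prefix w (l @ ys)) \<and>
    hst_path_weight lam p = (\<Sum>i\<in>{length l<..length l + length ys}. lam ^ i)"
  using assms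
proof (induction ys arbitrary: l)
  case Nil
  show ?case
    by (rule exI[of _ "[l]"]) (use Nil in \<open>auto simp: hst_path_def hst_path_weight_def\<close>)
next
  case (Cons a ys)
  from Cons.IH[of "l @ [a]"] Cons.prems obtain p where
    p: "hst_path b \<delta> (l @ [a]) (l @ a # ys) p"
      "\<forall>w \<in> set p. prefix (l @ [a]) w \<and> prefix w (l @ a # ys)"
      "hst_path_weight lam p = (\<Sum>i\<in>{Suc (length l)<..Suc (length l + length ys)}. lam ^ i)"
    by auto
  obtain p' where p': "p = (l @ [a]) # p'"
    using p(1) by (cases p) (auto simp: hst_path_def)
  have "l \<in> hst_vertices b \<delta>" using Cons.prems by (auto simp: hst_vertices_def)
  moreover have "l \<notin> set p" using p(2) by (auto simp: prefix_def)
  ultimately have "hst_path b \<delta> l (l @ a # ys) (l # p)"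
    using p(1) by (auto simp: p' hst_path_Cons_Cons hst_adjacent_def)
  moreover have "\<forall>w \<in> set (l # p). prefix l w \<and> prefix w (l @ a # ys)"
    using p(2) by (auto dest: append_prefixD)
  moreover have "hst_path_weight lam (l # p)
      = (\<Sum>i\<in>{length l<..length l + length (a # ys)}. lam ^ i)"
  proof -
    have "hst_path_weight lam (l # p) = lam ^ Suc (length l) + hst_path_weight lam p"
      by (simp add: p' hst_path_weight_def hst_edge_weight_def)
    moreover have "{length l<..length l + length (a # ys)}
        = insert (Suc (length l)) {Suc (length l)<..Suc (length l + length ys)}"
      by auto
    ultimately show ?thesis using p(3) by simp
  qed
  ultimately show ?case by blast
qed

text \<open>The third assumption says that \<open>l\<close> is the lowest common ancestor. Induction
  on \<open>xs\<close> from the right prepends ever deeper starting points; each one is new, being a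
  prefix of neither \<open>l @ xs\<close> nor \<open>l @ ys\<close>.\<close>

lemma hst_path_through_common_ancestor:
  assumes "l @ xs \<in> hst_vertices b \<delta>" "l @ ys \<in> hst_vertices b \<delta>"
    and "xs = [] \<or> ys = [] \<or> hd xs \<noteq> hd ys"
  shows "\<exists>p. hst_path b \<delta> (l @ xs) (l @ ys) p \<and>
    (\<forall>w \<in> set p. prefix w (l @ xs) \<or> prefix w (l @ ys)) \<and>
    hst_path_weight lam p = (\<Sum>i\<in>{length l<..length l + length xs}. lam ^ i)
      + (\<Sum>i\<in>{length l<..length l + length ys}. lam ^ i)"
  using assms
proof (induction xs rule: rev_induct)
  case Nil
  then show ?case using hst_path_downward[of l ys b \<delta> lam] by auto
next
  case (snoc a xs)
  from snoc have "\<exists>p. hst_path b \<delta> (l @ xs) (l @ ys) p \<and>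
    (\<forall>w \<in> set p. prefix w (l @ xs) \<or> prefix w (l @ ys)) \<and>
    hst_path_weight lam p = (\<Sum>i\<in>{length l<..length l + length xs}. lam ^ i)
      + (\<Sum>i\<in>{length l<..length l + length ys}. lam ^ i)"
    by (intro snoc.IH) (auto simp: hst_vertices_def hd_append split: if_splits)
  then obtain p where
    p: "hst_path b \<delta> (l @ xs) (l @ ys) p"
      "\<forall>w \<in> set p. prefix w (l @ xs) \<or> prefix w (l @ ys)"
      "hst_path_weight lam p = (\<Sum>i\<in>{length l<..length l + length xs}. lam ^ i)
      + (\<Sum>i\<in>{length l<..length l + length ys}. lam ^ i)"
    by auto
  let ?x = "l @ xs @ [a]"
  obtain p' where p': "p = (l @ xs) # p'"
    using p(1) by (cases p) (auto simp: hst_path_def)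
  have "\<not> prefix ?x (l @ xs)"
    by (metis append_assoc prefix_order.antisym prefixI append_Cons not_Cons_self2 self_append_conv)
  moreover have "\<not> prefix ?x (l @ ys)"
    using snoc.prems(3) by (cases xs; cases ys) auto
  ultimately have "?x \<notin> set p" using p(2) by blast
  then have "hst_path b \<delta> ?x (l @ ys) (?x # p)"
    using p(1) snoc.prems(1) by (auto simp: p' hst_path_Cons_Cons hst_adjacent_def)
  moreover have "\<forall>w \<in> set (?x # p). prefix w ?x \<or> prefix w (l @ ys)"
    using p(2) by (auto intro: prefix_order.trans simp flip: append_assoc)
  moreover have "hst_path_weight lam (?x # p)
      = (\<Sum>i\<in>{length l<..length l + length (xs @ [a])}. lam ^ i)
      + (\<Sum>i\<in>{length l<..length l + length ys}. lam ^ i)"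
  proof -
    have "hst_path_weight lam (?x # p) = lam ^ Suc (length l + length xs) + hst_path_weight lam p"
      by (simp add: p' hst_path_weight_def hst_edge_weight_def)
    moreover have "{length l<..length l + length (xs @ [a])}
        = insert (Suc (length l + length xs)) {length l<..length l + length xs}"
      by auto
    ultimately show ?thesis using p(3) by simp
  qed
  ultimately show ?case by blast
qed

text \<open>The path climbs to the longest common prefix and descends again. Both legs cross the
  same levels, whence the factor 2, and these are exactly the levels at which the truncations
  differ.\<close>

lemma hst_dist_leaves:
  assumes "x \<in> hst_leaves b \<delta>" "y \<in> hst_leaves b \<delta>"
  shows "hst_dist b \<delta> lam x y = 2 * (\<Sum>i\<in>{1..\<delta>}. lam ^ i * of_bool (take i x \<noteq> take i y))"
proof -
  define l where "l = longest_common_prefix x y"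
  obtain xs ys where xy: "x = l @ xs" "y = l @ ys"
    unfolding l_def by (metis longest_common_prefix_prefix1 longest_common_prefix_prefix2 prefixE)
  have neq: "xs = [] \<or> ys = [] \<or> hd xs \<noteq> hd ys"
  proof (rule ccontr)
    assume "\<not> ?thesis"
    then obtain a xs' ys' where "xs = a # xs'" "ys = a # ys'"
      by (metis list.collapse)
    then have "prefix (l @ [a]) (longest_common_prefix x y)"
      by (intro longest_common_prefix_max_prefix) (simp_all add: xy)
    then show False by (auto simp: prefix_def simp flip: l_def)
  qed
  have len: "length l + length xs = \<delta>" "length l + length ys = \<delta>"
    using assms by (auto simp: hst_leaves_def xy)
  obtain p where p: "hst_path b \<delta> x y p"
    "hst_path_weight lam p = 2 * (\<Sum>i\<in>{length l<..\<delta>}. lam ^ i)"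
    using hst_path_through_common_ancestor[of l xs b \<delta> ys lam] neq assms len
    by (auto simp: xy hst_leaves_def)
  have "hst_dist b \<delta> lam x y = hst_path_weight lam p"
    unfolding hst_dist_def using p(1) hst_path_unique by (metis the_equality)
  moreover have "(\<Sum>i\<in>{length l<..\<delta>}. lam ^ i) = (\<Sum>i\<in>{1..\<delta>}. lam ^ i * of_bool (take i x \<noteq> take i y))"
  proof (rule sum.mono_neutral_cong_left)
    have take_neq: "take i x \<noteq> take i y" if i: "i \<in> {length l<..\<delta>}" for i
    proof -
      obtain j where "i = Suc (length l + j)" using i less_iff_Suc_add by auto
      with neq i len show ?thesis by (cases xs; cases ys) (auto simp: xy)
    qed
    then show "lam ^ i = lam ^ i * of_bool (take i x \<noteq> take i y)" if "i \<in> {length l<..\<delta>}" for i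
      using that by simp
  qed (auto simp: xy)
  ultimately show ?thesis unfolding p(2) by simp
qed

section \<open>Alternating tours and imbalances\<close>

text \<open>In the application \<open>g\<close> maps a point to its ancestor at a fixed level, so a
  cut edge is one that pays for this level.\<close>

definition cuts :: "('a \<Rightarrow> 'b) \<Rightarrow> ('a \<times> 'a) list \<Rightarrow> nat" where
  "cuts g es = length (filter (\<lambda>(u, v). g u \<noteq> g v) es)"

lemma cuts_simps [simp]:
  "cuts g [] = 0"
  "cuts g ((u, v) # es) = of_bool (g u \<noteq> g v) + cuts g es"
  "cuts g (es @ es') = cuts g es + cuts g es'"
  by (auto simp: cuts_def)

abbreviation path_edges :: "'a list \<Rightarrow> ('a \<times> 'a) list" where
  "path_edges p \<equiv> zip p (tl p)"

lemma path_edges_append: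
  assumes "p \<noteq> []" "q \<noteq> []"
  shows "path_edges (p @ q) = path_edges p @ (last p, hd q) # path_edges q"
  using assms
proof (induction p rule: induct_list012)
  case (2 x)
  then show ?case by (cases q) auto
qed auto

lemma cycle_edges_eq:
  assumes "p \<noteq> []"
  shows "cycle_edges p = path_edges p @ [(last p, hd p)]"
proof -
  have "path_edges (q @ [y]) = zip q (tl q @ [y])" if "q \<noteq> []" for q and y :: 'a
    using that by (induction q rule: induct_list012) auto
  from this[OF assms, of "hd p"] path_edges_append[OF assms, of "[hd p]"] assms show ?thesis
    by (simp add: cycle_edges_def rotate1_hd_tl)
qed

lemma cuts_path_edges_rev: "cuts g (path_edges (rev p)) = cuts g (path_edges p)"
proof (induction p)
  case (Cons x p)
  show ?case
  proof (cases "p = []")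
    case False
    with path_edges_append[of "[x]" p] path_edges_append[of "rev p" "[x]"] Cons
    show ?thesis by (auto simp: last_rev)
  qed auto
qed auto

lemma cuts_path_edges_constant:
  assumes "\<forall>u \<in> set p. g u = c"
  shows "cuts g (path_edges p) = 0"
  using assms by (induction p rule: induct_list012) auto


lemma successively_path_edges:
  "successively P p \<longleftrightarrow> (\<forall>(u, v) \<in> set (path_edges p). P u v)"
  by (induction p rule: induct_list012) auto

text \<open>On a cycle every vertex is the first end of one edge and the second end of another entry
  of the edge list.\<close>

lemma sum_list_cycle_edges:
  fixes f :: "'a \<Rightarrow> 'b :: comm_monoid_add"
  shows "(\<Sum>(u, v)\<leftarrow>cycle_edges p. f u) = (\<Sum>u\<leftarrow>p. f u)"
    and "(\<Sum>(u, v)\<leftarrow>cycle_edges p. f v) = (\<Sum>u\<leftarrow>p. f u)"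
proof -
  have "(\<Sum>(u, v)\<leftarrow>cycle_edges p. f u) = sum_list (map f (map fst (cycle_edges p)))"
    by (simp add: case_prod_unfold comp_def)
  then show "(\<Sum>(u, v)\<leftarrow>cycle_edges p. f u) = (\<Sum>u\<leftarrow>p. f u)"
    by (simp add: cycle_edges_def)
  have "(\<Sum>(u, v)\<leftarrow>cycle_edges p. f v) = sum_list (map f (map snd (cycle_edges p)))"
    by (simp add: case_prod_unfold comp_def)
  then show "(\<Sum>(u, v)\<leftarrow>cycle_edges p. f v) = (\<Sum>u\<leftarrow>p. f u)"
    by (cases p) (simp_all add: cycle_edges_def add.commute)
qed

section \<open>Lower bound: the cuts forced by imbalances\<close>

definition imbalance :: "'a set \<Rightarrow> ('a \<Rightarrow> int) \<Rightarrow> ('a \<Rightarrow> 'b) \<Rightarrow> 'b \<Rightarrow> int" where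
  "imbalance A s g w = (\<Sum>u | u \<in> A \<and> g u = w. s u)"

text \<open>Double counting: twice the imbalance of \<open>w\<close> is the sum over all edges of
  the signs of their ends in \<open>w\<close>. Edges inside a class cancel, so only cut edges with
  an end in \<open>w\<close> contribute, at most 1 each. Over all \<open>w\<close> a cut edge is
  counted at most twice, which offsets the doubling.\<close>

lemma sum_abs_imbalance_le_cuts:
  assumes p: "distinct p" "set p = A" and W: "finite W"
    and s: "\<And>u. \<bar>s u\<bar> = 1" and alt: "\<forall>(u, v) \<in> set (cycle_edges p). s u \<noteq> s v"
  shows "(\<Sum>w\<in>W. \<bar>imbalance A s g w\<bar>) \<le> int (cuts g (cycle_edges p))"
proof -
  have s2: "s u + s v = 0" if "(u, v) \<in> set (cycle_edges p)" for u v
    using alt that s[of u] s[of v] by fastforce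
  have "2 * \<bar>imbalance A s g w\<bar>
      \<le> (\<Sum>(u, v)\<leftarrow>cycle_edges p. of_bool (g u \<noteq> g v) * (of_bool (g u = w) + of_bool (g v = w)))" for w
  proof -
    define f where "f u = of_bool (g u = w) * s u" for u
    have "imbalance A s g w = (\<Sum>u\<in>A. f u)"
      unfolding imbalance_def f_def using p(2)
      by (intro sum.mono_neutral_cong_left) auto
    also have "\<dots> = (\<Sum>u\<leftarrow>p. f u)"
      using p by (simp add: sum_list_distinct_conv_sum_set)
    finally have "2 * imbalance A s g w = (\<Sum>(u, v)\<leftarrow>cycle_edges p. f u) + (\<Sum>(u, v)\<leftarrow>cycle_edges p. f v)"
      by (simp add: sum_list_cycle_edges)
    also have "\<dots> = (\<Sum>(u, v)\<leftarrow>cycle_edges p. f u + f v)"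
      by (simp add: case_prod_unfold sum_list_addf)
    finally have "2 * \<bar>imbalance A s g w\<bar> = \<bar>\<Sum>(u, v)\<leftarrow>cycle_edges p. f u + f v\<bar>"
      by linarith
    also have "\<dots> \<le> (\<Sum>(u, v)\<leftarrow>cycle_edges p. \<bar>f u + f v\<bar>)"
      using sum_list_abs[of "map (\<lambda>(u, v). f u + f v) (cycle_edges p)"]
      by (simp add: comp_def case_prod_unfold)
    also have "\<dots> \<le> (\<Sum>(u, v)\<leftarrow>cycle_edges p.
        of_bool (g u \<noteq> g v) * (of_bool (g u = w) + of_bool (g v = w)))"
      using s2 s by (intro sum_list_mono) (auto simp: f_def)
    finally show ?thesis .
  qed
  then have "(\<Sum>w\<in>W. 2 * \<bar>imbalance A s g w\<bar>) \<le> (\<Sum>w\<in>W. \<Sum>(u, v)\<leftarrow>cycle_edges p.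
      of_bool (g u \<noteq> g v) * (of_bool (g u = w) + of_bool (g v = w)))"
    by (rule sum_mono)
  also have "\<dots> \<le> 2 * int (cuts g (cycle_edges p))"
  proof -
    have "(\<Sum>w\<in>W. \<Sum>(u, v)\<leftarrow>es. of_bool (g u \<noteq> g v) * (of_bool (g u = w) + of_bool (g v = w)))
        \<le> 2 * int (cuts g es)" for es
    proof (induction es)
      case (Cons e es)
      obtain u v where e: "e = (u, v)" by (cases e)
      have "(\<Sum>w\<in>W. of_bool (g u = w)) \<le> (1 :: int)" for u
        using W by (simp add: of_bool_def)
      from this[of u] this[of v] Cons show ?case
        by (simp add: e sum.distrib flip: sum_distrib_left)
    qed auto
    then show ?thesis .
  qed
  finally show ?thesis by (simp flip: sum_distrib_left)
qed

section \<open>Upper bound: merging alternating paths into a tour\<close>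

lemma sum_list_alternating:
  fixes s :: "'a \<Rightarrow> int"
  assumes "successively (\<lambda>u v. s u \<noteq> s v) p" "p \<noteq> []" and s: "\<And>u. \<bar>s u\<bar> = 1"
  shows "(\<Sum>u\<leftarrow>p. s u) = (if s (hd p) = s (last p) then s (hd p) else 0)"
  using assms(1,2)
proof (induction p rule: induct_list012)
  case (3 u v p)
  have "s u \<noteq> s v" using "3.prems" by simp
  \<comment> \<open>Signs of neighbours cancel, so prepending \<open>u\<close> either cancels a
    surplus or creates one.\<close>
  then have u: "s u = - s v" using s[of u] s[of v] by linarith
  have IH: "(\<Sum>u\<leftarrow>v # p. s u) = (if s v = s (last (v # p)) then s v else 0)"
    using 3 by simp
  have v: "s v \<noteq> 0" using s[of v] by auto
  have "s (last (v # p)) = s v \<or> s (last (v # p)) = - s v"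
    using s[of v] s[of "last (v # p)"] by linarith
  then have "s u + (\<Sum>u\<leftarrow>v # p. s u) = (if s u = s (last (v # p)) then s u else 0)"
    unfolding IH using u v by (elim disjE) simp_all
  then show ?case by simp
qed auto

text \<open>For finite \<open>A\<close>, equality of multisets says at once that the paths cover
  \<open>A\<close>, are disjoint and repeat no vertex.\<close>

definition alternating_cover :: "'a set \<Rightarrow> ('a \<Rightarrow> int) \<Rightarrow> 'a list multiset \<Rightarrow> bool" where
  "alternating_cover A s P \<longleftrightarrow>
     (\<forall>p \<in># P. p \<noteq> [] \<and> successively (\<lambda>u v. s u \<noteq> s v) p) \<and> (\<Sum>p\<in>#P. mset p) = mset_set A"

text \<open>The \<open>Suc\<close> reserves one cut per path for the edge that will later attach it
  to another path or close the cycle. With this reserve, joining two paths never increases the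
  quantity.\<close>

definition cover_cuts :: "('a \<Rightarrow> 'b) \<Rightarrow> 'a list multiset \<Rightarrow> nat" where
  "cover_cuts g P = (\<Sum>p\<in>#P. Suc (cuts g (path_edges p)))"

definition constant_on_paths :: "('a \<Rightarrow> 'b) \<Rightarrow> 'a list multiset \<Rightarrow> bool" where
  "constant_on_paths g P \<longleftrightarrow> (\<forall>p \<in># P. \<forall>u \<in> set p. g u = g (hd p))"

lemma constant_on_paths_add_mset:
  "constant_on_paths g (add_mset p P) \<longleftrightarrow> (\<forall>u \<in> set p. g u = g (hd p)) \<and> constant_on_paths g P"
  by (simp add: constant_on_paths_def)

lemma size_le_cover_cuts: "size P \<le> cover_cuts g P"
  by (induction P) (auto simp: cover_cuts_def)

lemma cover_cuts_constant:
  assumes "constant_on_paths g P"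
  shows "cover_cuts g P = size P"
  using assms
proof (induction P)
  case (add p P)
  then have "cuts g (path_edges p) = 0"
    by (intro cuts_path_edges_constant) (auto simp: constant_on_paths_def)
  with add show ?case by (simp add: cover_cuts_def constant_on_paths_def)
qed (simp add: cover_cuts_def)

text \<open>After reversing paths where necessary, any end of \<open>p\<close> can be linked to any
  end of \<open>q\<close> of a different colour; such a pair is missing only if all four ends agree.
  The single new edge adds at most one cut for every labelling simultaneously.\<close>

lemma join_alternating_paths:
  assumes p: "p \<noteq> []" "successively (\<lambda>u v. s u \<noteq> s v) p"
    and q: "q \<noteq> []" "successively (\<lambda>u v. s u \<noteq> s v) q"
    and ends: "\<not> (s (last p) = s (hd p) \<and> s (hd q) = s (hd p) \<and> s (last q) = s (hd p))"
  shows "\<exists>r. r \<noteq> [] \<and> successively (\<lambda>u v. s u \<noteq> s v) r \<and> mset r = mset p + mset q \<and>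
    (\<forall>g :: _ \<Rightarrow> 'b. cuts g (path_edges r) \<le> Suc (cuts g (path_edges p) + cuts g (path_edges q)))"
proof -
  have alternating_rev: "successively (\<lambda>u v. s u \<noteq> s v) (rev xs) \<longleftrightarrow> successively (\<lambda>u v. s u \<noteq> s v) xs" for xs
    unfolding successively_rev by (rule successively_cong) auto
  consider "s (last p) \<noteq> s (hd q)" | "s (last q) \<noteq> s (hd p)" | "s (last p) \<noteq> s (last q)" | "s (hd p) \<noteq> s (hd q)"
    using ends by force
  then show ?thesis
  proof cases
    case 1
    with p q show ?thesis
      by (intro exI[of _ "p @ q"]) (auto simp: successively_append_iff path_edges_append simp del: tl_append2)
  next
    case 2
    with p q show ?thesis
      by (intro exI[of _ "q @ p"]) (auto simp: successively_append_iff path_edges_append simp del: tl_append2)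
  next
    case 3
    with p q show ?thesis
      by (intro exI[of _ "p @ rev q"])
        (auto simp: successively_append_iff path_edges_append simp del: tl_append2 successively_rev simp add: cuts_path_edges_rev alternating_rev hd_rev)
  next
    case 4
    with p q show ?thesis
      by (intro exI[of _ "rev p @ q"])
        (auto simp: successively_append_iff path_edges_append simp del: tl_append2 successively_rev simp add: cuts_path_edges_rev alternating_rev last_rev)
  qed
qed

lemma size_eq_sum_fibres:
  assumes "finite W" "f ` set_mset P \<subseteq> W"
  shows "size P = (\<Sum>w\<in>W. size {#p \<in># P. f p = w#})"
  using assms(2)
proof (induction P)
  case (add x P)
  have "(\<Sum>w\<in>W. size {#p \<in># add_mset x P. f p = w#})
      = (\<Sum>w\<in>W. of_bool (w = f x) + size {#p \<in># P. f p = w#})"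
    by (intro sum.cong) auto
  also have "\<dots> = Suc (size P)"
    using add assms(1) by (simp add: sum.distrib of_bool_def)
  finally show ?case by simp
qed simp

text \<open>Each path lies within one class, so it contributes either all of its sign sum or
  nothing.\<close>

lemma imbalance_eq_sum_paths:
  assumes A: "finite A" and cover: "alternating_cover A s P" and const: "constant_on_paths g P"
  shows "imbalance A s g w = (\<Sum>p \<in># {#p \<in># P. g (hd p) = w#}. \<Sum>u\<leftarrow>p. s u)"
proof -
  define f where "f u = (if g u = w then s u else 0)" for u
  have "imbalance A s g w = (\<Sum>u\<in>A. f u)"
    unfolding imbalance_def f_def using A by (intro sum.mono_neutral_cong_left) auto
  also have "\<dots> = (\<Sum>u \<in># (\<Sum>p\<in>#P. mset p). f u)"
    using cover by (simp add: alternating_cover_def sum_unfold_sum_mset)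
  also have "\<dots> = (\<Sum>p \<in># {#p \<in># P. g (hd p) = w#}. \<Sum>u\<leftarrow>p. s u)"
    using const
  proof (induction P)
    case (add p P)
    have "(\<Sum>u\<leftarrow>p. f u) = (if g (hd p) = w then (\<Sum>u\<leftarrow>p. s u) else 0)"
    proof -
      have "map f p = map (\<lambda>u. if g (hd p) = w then s u else 0) p"
        using add.prems by (intro map_cong) (auto simp: f_def constant_on_paths_def)
      then show ?thesis by (cases "g (hd p) = w") (simp_all del: map_eq_conv)
    qed
    moreover have "(\<Sum>u \<in># mset p. f u) = (\<Sum>u\<leftarrow>p. f u)"
      by (simp flip: mset_map sum_mset_sum_list)
    ultimately show ?case using add by (auto simp: constant_on_paths_def)
  qed simp
  finally show ?thesis .
qed

text \<open>
  In a cover with the fewest paths no two paths inside the same class can be joined, so the paths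
  of a class either form a single path or all start and end in the same colour.
\<close>

lemma join_paths_in_classes:
  fixes g :: "'a \<Rightarrow> 'b"
  assumes A: "finite A" and s: "\<And>u. \<bar>s u\<bar> = 1"
    and P: "alternating_cover A s P" "constant_on_paths g P"
  shows "\<exists>P'. alternating_cover A s P' \<and> constant_on_paths g P' \<and>
    (\<forall>h :: 'a \<Rightarrow> 'b. cover_cuts h P' \<le> cover_cuts h P) \<and>
    int (size P') \<le> (\<Sum>w \<in> g ` A. max 1 \<bar>imbalance A s g w\<bar>)"
proof -
  \<comment> \<open>Minimality is taken among covers that are no worse than \<open>P\<close> for
    every labelling, since the deeper levels must keep their bounds.\<close>
  define ok where "ok P' \<longleftrightarrow> alternating_cover A s P' \<and> constant_on_paths g P' \<and>
    (\<forall>h :: 'a \<Rightarrow> 'b. cover_cuts h P' \<le> cover_cuts h P)" for P'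
  have "ok P" using P by (simp add: ok_def)
  then obtain P' where P': "ok P'" and min: "\<And>P''. ok P'' \<Longrightarrow> size P' \<le> size P''"
    using ex_has_least_nat[of ok P size] by blast
  note ok = P'[unfolded ok_def alternating_cover_def]
  \<comment> \<open>If some ends differed in colour, joining \<open>p\<close> and \<open>q\<close>
    would give an admissible cover with one path fewer.\<close>
  have ends: "s (last p) = s (hd p) \<and> s (hd q) = s (hd p) \<and> s (last q) = s (hd p)"
    if pq: "P' = add_mset p (add_mset q R)" "g (hd p) = g (hd q)" for p q R
  proof (rule ccontr)
    assume not_ends: "\<not> ?thesis"
    have alternating: "p \<noteq> []" "successively (\<lambda>u v. s u \<noteq> s v) p"
      "q \<noteq> []" "successively (\<lambda>u v. s u \<noteq> s v) q"
      using ok pq(1) by simp_all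
    obtain r where r: "r \<noteq> []" "successively (\<lambda>u v. s u \<noteq> s v) r" "mset r = mset p + mset q"
      "\<forall>g :: _ \<Rightarrow> 'b. cuts g (path_edges r) \<le> Suc (cuts g (path_edges p) + cuts g (path_edges q))"
      using join_alternating_paths[OF alternating not_ends, where 'b = 'b] by (elim exE conjE) (rule that)
    have set_r: "set r = set p \<union> set q"
      using r(3) by (metis set_mset_mset set_mset_union)
    have "g u = g (hd p)" if "u \<in> set r" for u
    proof -
      have "\<forall>u \<in> set p. g u = g (hd p)" "\<forall>u \<in> set q. g u = g (hd q)"
        using ok unfolding pq(1) constant_on_paths_add_mset by blast+
      with that pq(2) show ?thesis unfolding set_r by (metis UnE)
    qed
    then have "\<forall>u \<in> set r. g u = g (hd r)"
      using r(1) by (metis hd_in_set)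
    then have "constant_on_paths g (add_mset r R)"
      using ok unfolding pq(1) constant_on_paths_add_mset by blast
    moreover have "alternating_cover A s (add_mset r R)"
      using ok pq(1) r(1-3) by (simp add: alternating_cover_def add.assoc)
    moreover have "cover_cuts h (add_mset r R) \<le> cover_cuts h P" for h :: "'a \<Rightarrow> 'b"
    proof -
      have "cover_cuts h (add_mset r R) \<le> cover_cuts h P'"
        using r(4)[rule_format, of h] by (simp add: cover_cuts_def pq(1))
      also have "\<dots> \<le> cover_cuts h P" using ok by simp
      finally show ?thesis .
    qed
    ultimately have "ok (add_mset r R)" by (simp add: ok_def)
    from min[OF this] show False by (simp add: pq(1))
  qed
  have class_size: "int (size {#p \<in># P'. g (hd p) = w#}) \<le> max 1 \<bar>imbalance A s g w\<bar>" for w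
  proof -
    define Q where "Q = {#p \<in># P'. g (hd p) = w#}"
    show ?thesis
    proof (cases "size Q \<le> 1")
      case False
      then obtain p Q' where Q: "Q = add_mset p Q'" "Q' \<noteq> {#}"
        by (cases Q) auto
      have p_ends: "s (last p) = s (hd p) \<and> s (hd q) = s (hd p) \<and> s (last q) = s (hd p)" if "q \<in># Q'" for q
      proof -
        obtain Q'' where "Q' = add_mset q Q''" using multi_member_split \<open>q \<in># Q'\<close> by metis
        then have "P' = add_mset p (add_mset q (Q'' + {#p \<in># P'. g (hd p) \<noteq> w#}))"
          using Q(1) multiset_partition[of P' "\<lambda>p. g (hd p) = w"] by (simp add: Q_def)
        moreover have "g (hd p) = g (hd q)"
        proof -
          have "p \<in># Q" "q \<in># Q" using Q \<open>q \<in># Q'\<close> by auto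
          then show ?thesis by (simp add: Q_def)
        qed
        ultimately show ?thesis by (rule ends)
      qed
      \<comment> \<open>All paths of the class begin and end in the colour of \<open>hd p\<close>,
        so each has that sign as its sum and there is no cancellation between paths.\<close>
      have "(\<Sum>u\<leftarrow>q. s u) = s (hd p)" if "q \<in># Q" for q
      proof -
        have "q \<in># P'" using that by (simp add: Q_def)
        moreover obtain q0 where "q0 \<in># Q'" using Q(2) by auto
        ultimately show ?thesis
          using sum_list_alternating[of s q] s ok p_ends[of q0] p_ends[of q] that Q(1) by auto
      qed
      then have "(\<Sum>q\<in>#Q. \<Sum>u\<leftarrow>q. s u) = (\<Sum>q\<in>#Q. s (hd p))"
        by (intro arg_cong[where f = sum_mset] image_mset_cong) auto
      then have "imbalance A s g w = int (size Q) * s (hd p)"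
        using imbalance_eq_sum_paths[OF A, of s P' g w] P' by (simp add: ok_def Q_def)
      then have "\<bar>imbalance A s g w\<bar> = int (size Q)" using s by (simp add: abs_mult)
      then show ?thesis by (simp add: Q_def)
    qed (simp add: Q_def)
  qed
  have "set p \<subseteq> A" if "p \<in># P'" for p
  proof
    fix u assume "u \<in> set p"
    then have "u \<in># (\<Sum>p\<in>#P'. mset p)" using that by (auto simp: in_Union_mset_iff)
    then show "u \<in> A" using ok A by simp
  qed
  then have "(\<lambda>p. g (hd p)) ` set_mset P' \<subseteq> g ` A" using ok by fastforce
  from size_eq_sum_fibres[OF _ this] A
  have "int (size P') = (\<Sum>w \<in> g ` A. int (size {#p \<in># P'. g (hd p) = w#}))"
    by simp
  also have "\<dots> \<le> (\<Sum>w \<in> g ` A. max 1 \<bar>imbalance A s g w\<bar>)"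
    by (rule sum_mono) (rule class_size)
  finally show ?thesis using P' by (auto simp: ok_def)
qed

text \<open>Classes are processed from the finest level \<open>d\<close> to the coarsest level 0.
  Joins at level \<open>k\<close> raise no \<open>cover_cuts\<close>, so the bounds already obtained
  at finer levels survive. At level 0 there is one balanced class, hence one path is left, and its
  ends differ in colour, so it closes to an alternating cycle.\<close>

lemma exists_tour_with_few_cuts:
  fixes g :: "nat \<Rightarrow> 'a \<Rightarrow> 'b"
  assumes A: "finite A" "A \<noteq> {}" and s: "\<And>u. \<bar>s u\<bar> = 1" and balanced: "(\<Sum>u\<in>A. s u) = 0"
    and root: "\<And>u v. g 0 u = g 0 v"
    and refine: "\<And>i u v. g (Suc i) u = g (Suc i) v \<Longrightarrow> g i u = g i v"
  shows "\<exists>p. distinct p \<and> set p = A \<and> (\<forall>(u, v) \<in> set (cycle_edges p). s u \<noteq> s v) \<and>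
    (\<forall>i\<le>d. int (cuts (g i) (cycle_edges p)) \<le> (\<Sum>w \<in> g i ` A. max 1 \<bar>imbalance A s (g i) w\<bar>))"
proof -
  define M where "M i = (\<Sum>w \<in> g i ` A. max 1 \<bar>imbalance A s (g i) w\<bar>)" for i
  \<comment> \<open>Downward induction on \<open>k\<close>: levels from \<open>k\<close> on are
    settled, and no path yet leaves a class of a level below \<open>k\<close>.\<close>
  have "\<exists>P. alternating_cover A s P \<and> (\<forall>i<k. constant_on_paths (g i) P) \<and>
      (\<forall>i\<in>{k..d}. int (cover_cuts (g i) P) \<le> M i)" if "k \<le> Suc d" for k
    using that
  proof (induction rule: inc_induct)
    case base
    \<comment> \<open>The start is the cover by single points; \<open>{Suc d..d}\<close> is empty,
      so no bound is due yet.\<close>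
    define P where "P = image_mset (\<lambda>u. [u]) (mset_set A)"
    have "alternating_cover A s P \<and> (\<forall>i<Suc d. constant_on_paths (g i) P)"
      by (auto simp: P_def alternating_cover_def constant_on_paths_def multiset.map_comp comp_def)
    then show ?case by (intro exI[of _ P]) auto
  next
    case (step k)
    then obtain P where P: "alternating_cover A s P" "\<forall>i<Suc k. constant_on_paths (g i) P"
      "\<forall>i\<in>{Suc k..d}. int (cover_cuts (g i) P) \<le> M i"
      by blast
    obtain P' where P': "alternating_cover A s P'" "constant_on_paths (g k) P'"
      "\<forall>h :: 'a \<Rightarrow> 'b. cover_cuts h P' \<le> cover_cuts h P" "int (size P') \<le> M k"
      using join_paths_in_classes[OF A(1) s P(1), of "g k"] P(2) unfolding M_def by auto
    have mono: "g k u = g k v \<Longrightarrow> i \<le> k \<Longrightarrow> g i u = g i v" for i u v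
      by (induction k) (auto simp: le_Suc_eq dest: refine)
    then have "constant_on_paths (g i) P'" if "i < k" for i
      using P'(2) that unfolding constant_on_paths_def by (meson less_imp_le)
    moreover have "int (cover_cuts (g i) P') \<le> M i" if "i \<in> {k..d}" for i
    proof (cases "i = k")
      case True
      with P' show ?thesis by (simp add: cover_cuts_constant)
    next
      case False
      with that P(3) have "int (cover_cuts (g i) P) \<le> M i" by simp
      with P'(3)[rule_format, of "g i"] show ?thesis by linarith
    qed
    ultimately show ?case using P'(1) by blast
  qed
  from this[of 0] obtain P where P: "alternating_cover A s P" "\<forall>i\<in>{0..d}. int (cover_cuts (g i) P) \<le> M i"
    by auto
  obtain a where a: "a \<in> A" using A(2) by auto
  have "g 0 ` A = {g 0 a}" using root a by auto
  moreover have "imbalance A s (g 0) (g 0 a) = 0"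
    using balanced root by (simp add: imbalance_def)
  ultimately have "M 0 = 1" by (simp add: M_def)
  then have "size P \<le> 1" using P(2) size_le_cover_cuts[of P "g 0"] by force
  moreover have "P \<noteq> {#}" using P(1) A by (auto simp: alternating_cover_def mset_set_empty_iff)
  ultimately have "size P = 1" by (cases P) auto
  then obtain p where "P = {#p#}" using size_1_singleton_mset by blast
  with P(1) have p: "p \<noteq> []" "successively (\<lambda>u v. s u \<noteq> s v) p" "mset p = mset_set A"
    by (auto simp: alternating_cover_def)
  have set_p: "set p = A" using p(3) A(1) by (metis finite_set_mset_mset_set set_mset_mset)
  have distinct_p: "distinct p"
    using p(3) A(1) by (simp add: distinct_count_atmost_1 set_p)
  have "(\<Sum>u\<leftarrow>p. s u) = 0"
    using balanced distinct_p by (simp add: sum_list_distinct_conv_sum_set set_p)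
  then have "s (last p) \<noteq> s (hd p)"
    using sum_list_alternating[OF p(2,1) s] s[of "hd p"] by (auto split: if_splits)
  then have "\<forall>(u, v) \<in> set (cycle_edges p). s u \<noteq> s v"
    using p(1,2) by (auto simp: cycle_edges_eq successively_path_edges)
  moreover have "int (cuts (g i) (cycle_edges p)) \<le> M i" if "i \<le> d" for i
  proof -
    \<comment> \<open>The closing edge is paid for by the \<open>Suc\<close> in
      \<open>cover_cuts\<close>.\<close>
    have "cuts (g i) (cycle_edges p) \<le> cover_cuts (g i) P"
      using p(1) by (simp add: cycle_edges_eq cover_cuts_def \<open>P = {#p#}\<close>)
    moreover have "int (cover_cuts (g i) P) \<le> M i" using P(2) that by simp
    ultimately show ?thesis by linarith
  qed
  ultimately show ?thesis using set_p distinct_p unfolding M_def by blast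
qed

section \<open>Moments of the imbalance\<close>

lemma expectation_pair_pmf_finite:
  fixes f :: "'a \<times> 'b \<Rightarrow> real"
  assumes "finite (set_pmf p)" "finite (set_pmf q)"
  shows "measure_pmf.expectation (pair_pmf p q) f =
    measure_pmf.expectation p (\<lambda>x. measure_pmf.expectation q (\<lambda>y. f (x, y)))"
proof -
  have "measure_pmf.expectation (pair_pmf p q) f = (\<Sum>z\<in>set_pmf p \<times> set_pmf q. pmf (pair_pmf p q) z * f z)"
    using assms by (subst integral_measure_pmf[of "set_pmf p \<times> set_pmf q"]) auto
  also have "\<dots> = (\<Sum>x\<in>set_pmf p. pmf p x * (\<Sum>y\<in>set_pmf q. pmf q y * f (x, y)))"
    by (simp add: sum_distrib_left sum.cartesian_product, intro sum.cong)
      (auto simp: pmf_pair mult.assoc)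
  also have "\<dots> = measure_pmf.expectation p (\<lambda>x. measure_pmf.expectation q (\<lambda>y. f (x, y)))"
    using assms by (simp add: integral_measure_pmf[of "set_pmf p"] integral_measure_pmf[of "set_pmf q"])
  finally show ?thesis .
qed

lemma expectation_pmf_swap:
  fixes f :: "'a \<Rightarrow> 'b \<Rightarrow> real"
  assumes "finite (set_pmf p)" "finite (set_pmf q)"
  shows "measure_pmf.expectation p (\<lambda>x. measure_pmf.expectation q (f x)) =
    measure_pmf.expectation q (\<lambda>y. measure_pmf.expectation p (\<lambda>x. f x y))"
proof -
  have "measure_pmf.expectation p (\<lambda>x. measure_pmf.expectation q (f x))
      = (\<Sum>x\<in>set_pmf p. \<Sum>y\<in>set_pmf q. pmf p x * (pmf q y * f x y))"
    using assms by (simp add: integral_measure_pmf[of "set_pmf p"] integral_measure_pmf[of "set_pmf q"] sum_distrib_left)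
  also have "\<dots> = (\<Sum>y\<in>set_pmf q. \<Sum>x\<in>set_pmf p. pmf q y * (pmf p x * f x y))"
    by (subst sum.swap) (simp add: mult.left_commute)
  also have "\<dots> = measure_pmf.expectation q (\<lambda>y. measure_pmf.expectation p (\<lambda>x. f x y))"
    using assms by (simp add: integral_measure_pmf[of "set_pmf p"] integral_measure_pmf[of "set_pmf q"] sum_distrib_left)
  finally show ?thesis .
qed

text \<open>Pairing the \<open>k\<close>-th red with the \<open>k\<close>-th blue point turns the
  imbalance of a class into a walk with \<open>n\<close> independent steps in -1, 0, 1.\<close>

definition count_diff :: "('a \<Rightarrow> bool) \<Rightarrow> nat \<Rightarrow> (nat \<Rightarrow> 'a) \<times> (nat \<Rightarrow> 'a) \<Rightarrow> real" where
  "count_diff Q n = (\<lambda>(R, B). \<Sum>k<n. of_bool (Q (R k)) - of_bool (Q (B k)))"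

definition sample_pair :: "'a pmf \<Rightarrow> 'a \<Rightarrow> nat \<Rightarrow> ((nat \<Rightarrow> 'a) \<times> (nat \<Rightarrow> 'a)) pmf" where
  "sample_pair L d n = pair_pmf (Pi_pmf {..<n} d (\<lambda>_. L)) (Pi_pmf {..<n} d (\<lambda>_. L))"

lemma finite_set_Pi_pmf:
  assumes "finite (set_pmf L)"
  shows "finite (set_pmf (Pi_pmf {..<n::nat} d (\<lambda>_. L)))"
  using assms by (simp add: set_Pi_pmf comp_def finite_PiE_dflt)

lemma finite_set_sample_pair:
  assumes "finite (set_pmf L)"
  shows "finite (set_pmf (sample_pair L d n))"
  using assms by (simp add: sample_pair_def finite_set_Pi_pmf)

text \<open>Conditioning on the last red and the last blue point exhibits the walk as a shorter walk
  plus an independent step; this is the recursion behind all moments below.\<close>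

lemma expectation_count_diff_Suc:
  fixes f :: "real \<Rightarrow> real"
  assumes L: "finite (set_pmf L)"
  shows "measure_pmf.expectation (sample_pair L d (Suc n)) (\<lambda>\<omega>. f (count_diff Q (Suc n) \<omega>)) =
    measure_pmf.expectation (pair_pmf L L) (\<lambda>(x, y).
      measure_pmf.expectation (sample_pair L d n)
        (\<lambda>\<omega>. f (count_diff Q n \<omega> + (of_bool (Q x) - of_bool (Q y)))))"
proof -
  define P where "P n = Pi_pmf {..<n::nat} d (\<lambda>_. L)" for n
  have fin: "finite (set_pmf (P n))" for n using finite_set_Pi_pmf[OF L] by (simp add: P_def)
  have E_P: "measure_pmf.expectation (P (Suc n)) h
      = measure_pmf.expectation L (\<lambda>x. measure_pmf.expectation (P n) (\<lambda>R. h (R(n := x))))"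
    for h :: "(nat \<Rightarrow> 'a) \<Rightarrow> real"
    using expectation_pair_pmf_finite[OF L fin, of n "\<lambda>(x, R). h (R(n := x))"]
    by (simp add: P_def lessThan_Suc Pi_pmf_insert case_prod_unfold)
  define G where "G \<omega> = f (count_diff Q (Suc n) \<omega>)" for \<omega>
  have "measure_pmf.expectation (sample_pair L d (Suc n)) G
     = measure_pmf.expectation L (\<lambda>x. measure_pmf.expectation (P n) (\<lambda>R.
         measure_pmf.expectation L (\<lambda>y. measure_pmf.expectation (P n) (\<lambda>B.
           G (R(n := x), B(n := y))))))"
    unfolding sample_pair_def P_def[symmetric]
    \<comment> \<open>Next, the last blue point is moved outside the first \<open>n\<close> red
      ones.\<close>
    by (simp add: expectation_pair_pmf_finite fin E_P)
  also have "\<dots> = measure_pmf.expectation L (\<lambda>x. measure_pmf.expectation L (\<lambda>y.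
         measure_pmf.expectation (P n) (\<lambda>R. measure_pmf.expectation (P n) (\<lambda>B.
           G (R(n := x), B(n := y))))))"
    by (subst expectation_pmf_swap[OF fin L]) (rule refl)
  also have "\<dots> = measure_pmf.expectation (pair_pmf L L) (\<lambda>(x, y).
      measure_pmf.expectation (sample_pair L d n) (\<lambda>(R, B). G (R(n := x), B(n := y))))"
    unfolding sample_pair_def P_def[symmetric]
    by (simp add: expectation_pair_pmf_finite fin L)
  also have "\<dots> = measure_pmf.expectation (pair_pmf L L) (\<lambda>(x, y).
      measure_pmf.expectation (sample_pair L d n)
        (\<lambda>\<omega>. f (count_diff Q n \<omega> + (of_bool (Q x) - of_bool (Q y)))))"
  proof -
    have "(\<lambda>(R, B). G (R(n := x), B(n := y)))
        = (\<lambda>\<omega>. f (count_diff Q n \<omega> + (of_bool (Q x) - of_bool (Q y))))" for x y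
      by (auto simp: G_def count_diff_def intro!: ext)
    then show ?thesis by simp
  qed
  finally show ?thesis unfolding G_def .
qed

section \<open>Moments of the walk and its mean absolute value\<close>

context
  fixes L :: "'a pmf" and Q :: "'a \<Rightarrow> bool" and d :: 'a
  assumes L: "finite (set_pmf L)"
begin

private abbreviation E :: "nat \<Rightarrow> ((nat \<Rightarrow> 'a) \<times> (nat \<Rightarrow> 'a) \<Rightarrow> real) \<Rightarrow> real" where
  "E n \<equiv> measure_pmf.expectation (sample_pair L d n)"

text \<open>The variance of a difference of two independent Bernoulli variables with the same
  parameter.\<close>

private abbreviation step_var :: real where
  "step_var \<equiv> 2 * measure_pmf.prob L {x. Q x} * (1 - measure_pmf.prob L {x. Q x})"

private definition step :: "'a \<times> 'a \<Rightarrow> real" where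
  "step = (\<lambda>(x, y). of_bool (Q x) - of_bool (Q y))"

lemma integrable_sample_pair:
  "integrable (measure_pmf (sample_pair L d n)) (f :: _ \<Rightarrow> real)"
  by (rule integrable_measure_pmf_finite) (rule finite_set_sample_pair[OF L])

private lemma integrable_step: "integrable (measure_pmf (pair_pmf L L)) (f :: _ \<Rightarrow> real)"
  by (rule integrable_measure_pmf_finite) (simp add: L)

private lemma expectation_of_bool:
  "measure_pmf.expectation L (\<lambda>x. of_bool (Q x)) = measure_pmf.prob L {x. Q x}"
proof -
  have "(\<lambda>x. of_bool (Q x)) = (indicator {x. Q x} :: 'a \<Rightarrow> real)"
    by (auto simp: indicator_def)
  then show ?thesis by simp
qed

private lemma integrable_L: "integrable (measure_pmf L) (f :: _ \<Rightarrow> real)"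
  by (rule integrable_measure_pmf_finite) (simp add: L)

private lemma expectation_step: "measure_pmf.expectation (pair_pmf L L) step = 0"
  by (simp add: expectation_pair_pmf_finite L step_def expectation_of_bool integrable_L)

private lemma expectation_step_square:
  "measure_pmf.expectation (pair_pmf L L) (\<lambda>z. (step z)\<^sup>2) = step_var"
proof -
  \<comment> \<open>For indicators, the square of \<open>a - b\<close> is
    \<open>a + b - 2 * a * b\<close>, grouped here so that the inner expectation is over
    \<open>y\<close> alone.\<close>
  have "(\<lambda>z. (step z)\<^sup>2) = (\<lambda>(x, y). of_bool (Q x) + of_bool (Q y) * (1 - 2 * of_bool (Q x)))"
    by (auto simp: step_def fun_eq_iff)
  then show ?thesis
    by (simp add: expectation_pair_pmf_finite L expectation_of_bool integrable_L algebra_simps)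
qed

private lemma E_Suc:
  "E (Suc n) (\<lambda>\<omega>. f (count_diff Q (Suc n) \<omega>)) =
    measure_pmf.expectation (pair_pmf L L) (\<lambda>z. E n (\<lambda>\<omega>. f (count_diff Q n \<omega> + step z)))"
  using expectation_count_diff_Suc[OF L, of d n f Q] by (simp add: step_def case_prod_unfold)

private lemma expectation_count_diff: "E n (count_diff Q n) = 0"
proof (induction n)
  case 0
  show ?case by (simp add: count_diff_def case_prod_unfold)
next
  case (Suc n)
  then show ?case
    using E_Suc[of n "\<lambda>x. x"] by (simp add: integrable_sample_pair integrable_step expectation_step)
qed

lemma expectation_count_diff_square:
  "E n (\<lambda>\<omega>. (count_diff Q n \<omega>)\<^sup>2) = real n * step_var"
proof (induction n)
  case 0
  show ?case by (simp add: count_diff_def case_prod_unfold)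
next
  case (Suc n)
  have "E n (\<lambda>\<omega>. (count_diff Q n \<omega> + c)\<^sup>2) = E n (\<lambda>\<omega>. (count_diff Q n \<omega>)\<^sup>2) + c\<^sup>2" for c
    using expectation_count_diff[of n]
    by (simp add: power2_sum integrable_sample_pair)
  then show ?case
    unfolding E_Suc[of n "\<lambda>x. x\<^sup>2"]
    by (simp add: Suc integrable_step expectation_step_square) (simp add: algebra_simps)
qed

text \<open>An exact formula is proved by induction and then weakened. In the expansion, the cubic
  moment is multiplied by the mean of a step and the cube of a step by the mean of the walk, both
  zero; the fourth power of a step equals its square.\<close>

lemma expectation_count_diff_power4:
  "E n (\<lambda>\<omega>. (count_diff Q n \<omega>) ^ 4) \<le> real n * step_var + 3 * (real n * step_var)\<^sup>2"
proof -
  have "E n (\<lambda>\<omega>. (count_diff Q n \<omega>) ^ 4)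
      = real n * step_var + 3 * real n * (real n - 1) * step_var\<^sup>2"
  proof (induction n)
    case 0
    show ?case by (simp add: count_diff_def case_prod_unfold)
  next
    case (Suc n)
    define m where "m j = E n (\<lambda>\<omega>. (count_diff Q n \<omega>) ^ j)" for j
    have m1: "m 1 = 0" using expectation_count_diff[of n] by (simp add: m_def)
    have m2: "m 2 = real n * step_var" using expectation_count_diff_square[of n] by (simp add: m_def)
    have "E n (\<lambda>\<omega>. (count_diff Q n \<omega> + c) ^ 4)
        = m 4 + 4 * c * m 3 + 6 * c\<^sup>2 * m 2 + c ^ 4" for c
    proof -
      have expand: "(a + c) ^ 4 = a ^ 4 + 4 * c * a ^ 3 + 6 * c\<^sup>2 * a\<^sup>2 + 4 * c ^ 3 * a ^ 1 + c ^ 4" for a :: real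
        by (simp add: power4_eq_xxxx power2_eq_square power3_eq_cube algebra_simps)
      show ?thesis
        unfolding expand using m1 by (simp add: integrable_sample_pair m_def)
    qed
    moreover have "step z ^ 4 = (step z)\<^sup>2" for z
      by (cases z) (auto simp: step_def)
    ultimately have "E (Suc n) (\<lambda>\<omega>. (count_diff Q (Suc n) \<omega>) ^ 4)
        = m 4 + 6 * step_var * m 2 + step_var"
      unfolding E_Suc[of n "\<lambda>x. x ^ 4"]
      by (simp add: integrable_step expectation_step_square expectation_step)
    then show ?case
      unfolding m2 unfolding m_def Suc by (simp add: algebra_simps power2_eq_square)
  qed
  also have "\<dots> \<le> real n * step_var + 3 * (real n * step_var)\<^sup>2"
  proof -
    have "3 * real n * (real n - 1) * s\<^sup>2 \<le> 3 * (real n * s)\<^sup>2" for s :: real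
    proof -
      have "0 \<le> real n * s\<^sup>2" by simp
      then show ?thesis by (simp add: power2_eq_square algebra_simps)
    qed
    then show ?thesis by simp
  qed
  finally show ?thesis .
qed

text \<open>Integrates a rearrangement of the nonnegativity of the square of
  \<open>\<bar>x\<bar> - t\<close>. The parameter \<open>t\<close> stays free, to be set to the
  order of the standard deviation.\<close>

lemma expectation_abs_count_diff_le:
  assumes "t > 0"
  shows "E n (\<lambda>\<omega>. \<bar>count_diff Q n \<omega>\<bar>) \<le> (real n * step_var / t + t) / 2"
proof -
  have "\<bar>x\<bar> \<le> (x\<^sup>2 / t + t) / 2" for x
  proof -
    have "0 \<le> (\<bar>x\<bar> - t)\<^sup>2" by simp
    then have "2 * t * \<bar>x\<bar> \<le> x\<^sup>2 + t\<^sup>2" by (simp add: power2_diff algebra_simps)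
    then show ?thesis using assms by (simp add: field_simps power2_eq_square)
  qed
  then have "E n (\<lambda>\<omega>. \<bar>count_diff Q n \<omega>\<bar>) \<le> E n (\<lambda>\<omega>. ((count_diff Q n \<omega>)\<^sup>2 / t + t) / 2)"
    by (intro integral_mono integrable_sample_pair)
  also have "\<dots> = (real n * step_var / t + t) / 2"
    by (simp add: integrable_sample_pair expectation_count_diff_square)
  finally show ?thesis .
qed

text \<open>
  The bound comes from the pointwise inequality \<open>\<bar>x\<bar> \<ge> x\<^sup>2 / t - x ^ 4 / (4 * t ^ 3)\<close> at
  \<open>t = 2 * sqrt (real n * step_var)\<close>.
\<close>

lemma expectation_abs_count_diff_ge:
  assumes "real n * step_var \<ge> 1"
  shows "3 / 8 * sqrt (real n * step_var) \<le> E n (\<lambda>\<omega>. \<bar>count_diff Q n \<omega>\<bar>)"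
proof -
  define V where "V = real n * step_var"
  define r where "r = sqrt V"
  have V: "V \<ge> 1" using assms by (simp add: V_def)
  then have r: "r \<ge> 1" "V = r\<^sup>2" by (simp_all add: r_def)
  define t where "t = 2 * r"
  have t: "t > 0" using r by (simp add: t_def)
  have pointwise: "x\<^sup>2 / t - x ^ 4 / (4 * t ^ 3) \<le> \<bar>x\<bar>" for x
  proof -
    define u where "u = \<bar>x\<bar> / t"
    have u: "u \<ge> 0" "\<bar>x\<bar> = u * t" using t by (simp_all add: u_def)
    have "u\<^sup>2 - u ^ 4 / 4 \<le> u"
    proof (cases "u \<le> 2")
      case True
      \<comment> \<open>The product expands to \<open>u ^ 4 - 4 * u\<^sup>2 + 4 * u\<close>.\<close>
      then have "0 \<le> u * ((u - 1)\<^sup>2 * (u + 2) + (2 - u))"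
        using u(1) by (intro mult_nonneg_nonneg add_nonneg_nonneg) auto
      then show ?thesis by (simp add: power4_eq_xxxx power2_eq_square algebra_simps)
    next
      case False
      then have "u\<^sup>2 * 2\<^sup>2 \<le> u\<^sup>2 * u\<^sup>2" by (intro mult_left_mono power_mono) auto
      then have "u\<^sup>2 \<le> u ^ 4 / 4" by (simp flip: power_add)
      with u(1) show ?thesis by linarith
    qed
    then have "(u\<^sup>2 - u ^ 4 / 4) * t \<le> u * t" using t by (intro mult_right_mono) auto
    moreover have x2: "x\<^sup>2 = (u * t)\<^sup>2" by (metis u(2) power2_abs)
    moreover have "x ^ 4 = (u * t) ^ 4" using arg_cong[OF x2, of "\<lambda>z. z\<^sup>2"] by simp
    ultimately show ?thesis
      using t u(2) by (simp add: field_simps power4_eq_xxxx power2_eq_square power3_eq_cube)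
  qed
  \<comment> \<open>Since \<open>V\<close> is at least 1, the linear term of the fourth moment is
    absorbed into the quadratic one.\<close>
  have "E n (\<lambda>\<omega>. (count_diff Q n \<omega>) ^ 4) \<le> 4 * V\<^sup>2"
  proof -
    have "V \<le> V\<^sup>2" using V by (simp add: power2_eq_square)
    with expectation_count_diff_power4[of n] show ?thesis by (simp add: V_def)
  qed
  then have "V / t - 4 * V\<^sup>2 / (4 * t ^ 3)
      \<le> V / t - E n (\<lambda>\<omega>. (count_diff Q n \<omega>) ^ 4) / (4 * t ^ 3)"
    using t by (intro diff_left_mono divide_right_mono) auto
  also have "\<dots> = E n (\<lambda>\<omega>. (count_diff Q n \<omega>)\<^sup>2 / t - (count_diff Q n \<omega>) ^ 4 / (4 * t ^ 3))"
    by (simp add: integrable_sample_pair expectation_count_diff_square V_def)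
  also have "\<dots> \<le> E n (\<lambda>\<omega>. \<bar>count_diff Q n \<omega>\<bar>)"
    by (intro integral_mono integrable_sample_pair pointwise)
  \<comment> \<open>At \<open>t = 2 * r\<close> the two terms are \<open>r / 2\<close> and
    \<open>r / 8\<close>.\<close>
  also have "V / t - 4 * V\<^sup>2 / (4 * t ^ 3) = 3 / 8 * r"
    using r by (simp add: t_def field_simps power4_eq_xxxx power2_eq_square power3_eq_cube)
  finally show ?thesis by (simp add: r_def V_def)
qed

end

section \<open>The expected cost\<close>

lemma card_hst_leaves: "finite (hst_leaves b \<delta>)" "card (hst_leaves b \<delta>) = b ^ \<delta>"
proof -
  have "hst_leaves b \<delta> = {v. set v \<subseteq> {..<b} \<and> length v = \<delta>}"
    by (auto simp: hst_leaves_def hst_vertices_def)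
  then show "finite (hst_leaves b \<delta>)" "card (hst_leaves b \<delta>) = b ^ \<delta>"
    by (simp_all add: finite_lists_length_eq card_lists_length_eq)
qed

text \<open>From here on \<open>hst_leaves b i\<close> also serves as the set of level
  \<open>i\<close> vertices of a tree of depth at least \<open>i\<close>.\<close>

lemma take_in_hst_leaves:
  assumes "x \<in> hst_leaves b \<delta>" "i \<le> \<delta>"
  shows "take i x \<in> hst_leaves b i"
  using assms set_take_subset[of i x] by (auto simp: hst_leaves_def hst_vertices_def)

lemma prob_leaf_below:
  assumes b: "b > 0" and i: "i \<le> \<delta>" and v: "v \<in> hst_leaves b i"
  shows "measure_pmf.prob (pmf_of_set (hst_leaves b \<delta>)) {x. take i x = v} = 1 / real (b ^ i)"
proof -
  have "hst_leaves b \<delta> \<inter> {x. take i x = v} = (@) v ` hst_leaves b (\<delta> - i)"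
  proof (intro set_eqI iffI)
    fix x assume x: "x \<in> hst_leaves b \<delta> \<inter> {x. take i x = v}"
    then have "x = v @ drop i x" by auto
    moreover have "drop i x \<in> hst_leaves b (\<delta> - i)"
      using x set_drop_subset[of i x] by (auto simp: hst_leaves_def hst_vertices_def)
    ultimately show "x \<in> (@) v ` hst_leaves b (\<delta> - i)" by blast
  qed (use v i in \<open>auto simp: hst_leaves_def hst_vertices_def\<close>)
  then have "card (hst_leaves b \<delta> \<inter> {x. take i x = v}) = b ^ (\<delta> - i)"
    by (simp add: card_image inj_on_def card_hst_leaves)
  moreover have "hst_leaves b \<delta> \<noteq> {}" using card_hst_leaves(2)[of b \<delta>] b by auto
  ultimately have "measure_pmf.prob (pmf_of_set (hst_leaves b \<delta>)) {x. take i x = v}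
      = real (b ^ (\<delta> - i)) / real (b ^ \<delta>)"
    by (simp add: measure_pmf_of_set card_hst_leaves)
  also have "\<dots> = 1 / real (b ^ i)"
  proof -
    have "b ^ \<delta> = b ^ (\<delta> - i) * b ^ i" using i by (simp flip: power_add)
    then show ?thesis using b by simp
  qed
  finally show ?thesis .
qed

section \<open>From tours on coloured points to the random walk\<close>

definition colour_sign :: "nat + nat \<Rightarrow> int" where
  "colour_sign u = (if isl u then 1 else - 1)"

lemma abs_colour_sign [simp]: "\<bar>colour_sign u\<bar> = 1"
  by (simp add: colour_sign_def)

abbreviation points :: "nat \<Rightarrow> (nat + nat) set" where
  "points n \<equiv> {..<n} <+> {..<n}"

lemma imbalance_points:
  "real_of_int (imbalance (points n) colour_sign (\<lambda>u. f (case_sum R B u)) v)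
    = count_diff (\<lambda>x. f x = v) n (R, B)"
proof -
  have "real_of_int (imbalance (points n) colour_sign (\<lambda>u. f (case_sum R B u)) v)
      = (\<Sum>u\<in>points n. of_bool (f (case_sum R B u) = v) * real_of_int (colour_sign u))"
    unfolding imbalance_def of_int_sum by (intro sum.mono_neutral_cong_left) auto
  also have "\<dots> = count_diff (\<lambda>x. f x = v) n (R, B)"
    by (subst sum.Plus) (simp_all add: count_diff_def colour_sign_def sum_subtractf sum_negf)
  finally show ?thesis .
qed

lemma tour_cost_eq:
  assumes leaves: "\<And>k. k < n \<Longrightarrow> R k \<in> hst_leaves b \<delta>" "\<And>k. k < n \<Longrightarrow> B k \<in> hst_leaves b \<delta>"
    and p: "set p \<subseteq> points n"
  shows "tour_cost b \<delta> lam R B p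
    = 2 * (\<Sum>i\<in>{1..\<delta>}. lam ^ i * real (cuts (\<lambda>u. take i (case_sum R B u)) (cycle_edges p)))"
proof -
  let ?loc = "case_sum R B"
  have "(\<Sum>(u, v)\<leftarrow>es. hst_dist b \<delta> lam (?loc u) (?loc v))
      = 2 * (\<Sum>i\<in>{1..\<delta>}. lam ^ i * real (cuts (\<lambda>u. take i (?loc u)) es))"
    if "set es \<subseteq> points n \<times> points n" for es
    using that
  proof (induction es)
    case (Cons e es)
    obtain u v where e: "e = (u, v)" by (cases e)
    have "?loc u \<in> hst_leaves b \<delta>" "?loc v \<in> hst_leaves b \<delta>"
      using Cons.prems leaves by (auto simp: e)
    then show ?case
      using Cons by (simp add: e hst_dist_leaves sum.distrib algebra_simps)
  qed simp
  moreover have "set (cycle_edges p) \<subseteq> points n \<times> points n"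
    using p by (auto simp: cycle_edges_def elim!: in_set_zipE)
  ultimately show ?thesis unfolding tour_cost_def by blast
qed

lemma finite_bichromatic_tours: "finite {p. bichromatic_tour n p}"
proof (rule finite_subset)
  show "{p. bichromatic_tour n p} \<subseteq> {p. set p \<subseteq> points n \<and> distinct p}"
    by (auto simp: bichromatic_tour_def)
qed (simp add: finite_subset_distinct)

lemma bichromatic_tour_iff:
  "bichromatic_tour n p \<longleftrightarrow> distinct p \<and> set p = points n \<and>
    (\<forall>(u, v) \<in> set (cycle_edges p). colour_sign u \<noteq> colour_sign v)"
  by (auto simp: bichromatic_tour_def colour_sign_def split: if_splits)

text \<open>A deterministic sandwich for fixed samples: every tour obeys the lower bound, and one
  tour is good at all levels at once. The cap \<open>2 * real n\<close> is for levels with more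
  vertices than points, where a summand 1 per vertex is too expensive.\<close>

lemma opt_tour_cost_bounds:
  assumes n: "n > 0" and lam: "lam \<ge> 0"
    and leaves: "\<And>k. k < n \<Longrightarrow> R k \<in> hst_leaves b \<delta>" "\<And>k. k < n \<Longrightarrow> B k \<in> hst_leaves b \<delta>"
  shows "2 * (\<Sum>i\<in>{1..\<delta>}. lam ^ i * (\<Sum>v\<in>hst_leaves b i. \<bar>count_diff (\<lambda>x. take i x = v) n (R, B)\<bar>))
      \<le> opt_tour_cost b \<delta> lam n R B" (is "?lower \<le> _")
    and "opt_tour_cost b \<delta> lam n R B \<le> 2 * (\<Sum>i\<in>{1..\<delta>}. lam ^ i *
      min (2 * real n) (\<Sum>v\<in>hst_leaves b i. 1 + \<bar>count_diff (\<lambda>x. take i x = v) n (R, B)\<bar>))"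
      (is "_ \<le> ?upper")
proof -
  define g where "g i u = take i (case_sum R B u)" for i u
  have cost: "tour_cost b \<delta> lam R B p = 2 * (\<Sum>i\<in>{1..\<delta>}. lam ^ i * real (cuts (g i) (cycle_edges p)))"
    if "bichromatic_tour n p" for p
    using tour_cost_eq[OF leaves, where p = p and lam = lam] that
    by (simp add: g_def[abs_def] bichromatic_tour_def)
  note imbalance = imbalance_points[of n "take _" R B, folded g_def]
  have lower: "?lower \<le> tour_cost b \<delta> lam R B p" if p: "bichromatic_tour n p" for p
  proof -
    have "(\<Sum>v\<in>hst_leaves b i. \<bar>count_diff (\<lambda>x. take i x = v) n (R, B)\<bar>)
        \<le> real (cuts (g i) (cycle_edges p))" for i
    proof -
      have "real_of_int (\<Sum>v\<in>hst_leaves b i. \<bar>imbalance (points n) colour_sign (g i) v\<bar>)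
          \<le> real_of_int (int (cuts (g i) (cycle_edges p)))"
        using p unfolding of_int_le_iff bichromatic_tour_iff
        by (intro sum_abs_imbalance_le_cuts) (auto simp: card_hst_leaves)
      then show ?thesis by (simp flip: imbalance)
    qed
    then show ?thesis
      unfolding cost[OF p] using lam by (intro mult_left_mono sum_mono) auto
  qed
  have balanced: "(\<Sum>u\<in>points n. colour_sign u) = 0"
    by (simp add: sum.Plus colour_sign_def)
  have nonempty: "points n \<noteq> {}" using n by auto
  have root: "g 0 u = g 0 v" for u v by (simp add: g_def)
  have refine: "g i u = g i v" if "g (Suc i) u = g (Suc i) v" for i u v
    using arg_cong[OF that, of "take i"] by (simp add: g_def min_def)
  have fin: "finite (points n)" by simp
  obtain p where p: "distinct p" "set p = points n"
      "\<forall>(u, v) \<in> set (cycle_edges p). colour_sign u \<noteq> colour_sign v"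
    and cuts: "\<forall>i\<le>\<delta>. int (cuts (g i) (cycle_edges p))
      \<le> (\<Sum>w \<in> g i ` points n. max 1 \<bar>imbalance (points n) colour_sign (g i) w\<bar>)"
    by (rule exE[OF exists_tour_with_few_cuts[where g = g and d = \<delta>,
        OF fin nonempty abs_colour_sign balanced root]], erule refine, elim conjE, rule that)
  have tour: "bichromatic_tour n p" using p by (simp add: bichromatic_tour_iff)
  have "real (cuts (g i) (cycle_edges p))
      \<le> min (2 * real n) (\<Sum>v\<in>hst_leaves b i. 1 + \<bar>count_diff (\<lambda>x. take i x = v) n (R, B)\<bar>)"
    if i: "i \<in> {1..\<delta>}" for i
  proof -
    let ?D = "\<lambda>w. \<bar>imbalance (points n) colour_sign (g i) w\<bar>"
    \<comment> \<open>A nonempty class contains at least one point and at least \<open>?D w\<close>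
      points, so the sum is bounded by the total number of points.\<close>
    have "(\<Sum>w \<in> g i ` points n. max 1 (?D w))
        \<le> (\<Sum>w \<in> g i ` points n. \<Sum>u | u \<in> points n \<and> g i u = w. 1)"
    proof (rule sum_mono)
      fix w assume "w \<in> g i ` points n"
      then obtain u where u: "u \<in> points n" "g i u = w" by auto
      have "?D w \<le> (\<Sum>u | u \<in> points n \<and> g i u = w. \<bar>colour_sign u\<bar>)"
        unfolding imbalance_def by (rule sum_abs)
      moreover have "card {u \<in> points n. g i u = w} > 0"
        using u by (subst card_gt_0_iff) auto
      ultimately show "max 1 (?D w) \<le> (\<Sum>u | u \<in> points n \<and> g i u = w. 1)" by simp
    qed
    also have "\<dots> = 2 * int n"
      by (subst sum.image_gen[OF fin, symmetric]) (simp add: card_Plus)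
    finally have 1: "(\<Sum>w \<in> g i ` points n. max 1 (?D w)) \<le> 2 * int n" .
    have "g i ` points n \<subseteq> hst_leaves b i"
      using leaves i by (auto simp: g_def intro!: take_in_hst_leaves)
    \<comment> \<open>Passing from the occupied vertices to all vertices of the level makes the
      index set independent of the sample.\<close>
    then have "(\<Sum>w \<in> g i ` points n. max 1 (?D w)) \<le> (\<Sum>w\<in>hst_leaves b i. max 1 (?D w))"
      by (intro sum_mono2 card_hst_leaves) auto
    also have "\<dots> \<le> (\<Sum>w\<in>hst_leaves b i. 1 + ?D w)"
      by (intro sum_mono) auto
    finally have 2: "(\<Sum>w \<in> g i ` points n. max 1 (?D w)) \<le> (\<Sum>w\<in>hst_leaves b i. 1 + ?D w)" .
    have "int (cuts (g i) (cycle_edges p)) \<le> min (2 * int n) (\<Sum>w\<in>hst_leaves b i. 1 + ?D w)"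
      using cuts i 1 2 by fastforce
    then have "real_of_int (int (cuts (g i) (cycle_edges p)))
        \<le> real_of_int (min (2 * int n) (\<Sum>w\<in>hst_leaves b i. 1 + ?D w))"
      unfolding of_int_le_iff .
    then show ?thesis by (simp add: of_int_min flip: imbalance)
  qed
  then have upper: "tour_cost b \<delta> lam R B p \<le> ?upper"
    unfolding cost[OF tour] using lam by (intro mult_left_mono sum_mono) auto
  show "?lower \<le> opt_tour_cost b \<delta> lam n R B"
    unfolding opt_tour_cost_def using tour lower finite_bichromatic_tours by (subst Min_ge_iff) auto
  show "opt_tour_cost b \<delta> lam n R B \<le> ?upper"
    unfolding opt_tour_cost_def using tour upper finite_bichromatic_tours
    by (intro order_trans[OF Min_le upper]) auto
qed

text \<open>The sandwich is averaged by linearity; for the upper bound, the expectation of a minimum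
  is at most the minimum of the expectations.\<close>

lemma expected_opt_tour_cost_bounds:
  fixes lam :: real and b \<delta> n :: nat
  assumes b: "b > 0" and n: "n > 0" and lam: "lam \<ge> 0"
  defines "L \<equiv> pmf_of_set (hst_leaves b \<delta>)"
  defines "D \<equiv> \<lambda>i v. measure_pmf.expectation (sample_pair L [] n) (\<lambda>\<omega>. \<bar>count_diff (\<lambda>x. take i x = v) n \<omega>\<bar>)"
  shows "2 * (\<Sum>i\<in>{1..\<delta>}. lam ^ i * (\<Sum>v\<in>hst_leaves b i. D i v)) \<le> expected_opt_tour_cost b \<delta> lam n"
    and "expected_opt_tour_cost b \<delta> lam n \<le>
      2 * (\<Sum>i\<in>{1..\<delta>}. lam ^ i * min (2 * real n) (\<Sum>v\<in>hst_leaves b i. 1 + D i v))"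
proof -
  have "hst_leaves b \<delta> \<noteq> {}" using card_hst_leaves(2)[of b \<delta>] b by auto
  then have set_L: "set_pmf L = hst_leaves b \<delta>"
    by (simp add: L_def card_hst_leaves)
  then have fin: "finite (set_pmf L)" by (simp add: card_hst_leaves)
  note int = integrable_sample_pair[OF fin, of "[]" n]
  have leaves: "R k \<in> hst_leaves b \<delta> \<and> B k \<in> hst_leaves b \<delta>"
    if "(R, B) \<in> set_pmf (sample_pair L [] n)" "k < n" for R B k
    using that by (auto simp: sample_pair_def set_Pi_pmf PiE_dflt_def set_L)
  define X :: "_ \<Rightarrow> nat \<Rightarrow> nat list \<Rightarrow> real"
    where "X = (\<lambda>\<omega>. \<lambda>i v. \<bar>count_diff (\<lambda>x. take i x = v) n \<omega>\<bar>)"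
  have expected: "expected_opt_tour_cost b \<delta> lam n
      = measure_pmf.expectation (sample_pair L [] n) (\<lambda>(R, B). opt_tour_cost b \<delta> lam n R B)"
    by (simp add: expected_opt_tour_cost_def sample_pair_def random_leaves_def L_def)
  have "2 * (\<Sum>i\<in>{1..\<delta>}. lam ^ i * (\<Sum>v\<in>hst_leaves b i. D i v))
     = measure_pmf.expectation (sample_pair L [] n)
         (\<lambda>\<omega>. 2 * (\<Sum>i\<in>{1..\<delta>}. lam ^ i * (\<Sum>v\<in>hst_leaves b i. X \<omega> i v)))"
    by (simp add: int D_def X_def)
  also have "\<dots> \<le> expected_opt_tour_cost b \<delta> lam n"
    unfolding expected
    by (intro integral_mono_AE int AE_pmfI)
      (use opt_tour_cost_bounds(1)[OF n lam] leaves in \<open>force simp: X_def\<close>)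
  finally show "2 * (\<Sum>i\<in>{1..\<delta>}. lam ^ i * (\<Sum>v\<in>hst_leaves b i. D i v)) \<le> expected_opt_tour_cost b \<delta> lam n" .
  have "expected_opt_tour_cost b \<delta> lam n \<le> measure_pmf.expectation (sample_pair L [] n)
         (\<lambda>\<omega>. 2 * (\<Sum>i\<in>{1..\<delta>}. lam ^ i * min (2 * real n) (\<Sum>v\<in>hst_leaves b i. 1 + X \<omega> i v)))"
    unfolding expected
    by (intro integral_mono_AE int AE_pmfI)
      (use opt_tour_cost_bounds(2)[OF n lam] leaves in \<open>force simp: X_def\<close>)
  also have "\<dots> = 2 * (\<Sum>i\<in>{1..\<delta>}. lam ^ i * measure_pmf.expectation (sample_pair L [] n)
       (\<lambda>\<omega>. min (2 * real n) (\<Sum>v\<in>hst_leaves b i. 1 + X \<omega> i v)))"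
    by (simp add: int)
  also have "\<dots> \<le> 2 * (\<Sum>i\<in>{1..\<delta>}. lam ^ i * min (2 * real n) (\<Sum>v\<in>hst_leaves b i. 1 + D i v))"
  proof (intro mult_left_mono sum_mono)
    fix i
    have "measure_pmf.expectation (sample_pair L [] n) (\<lambda>\<omega>. min (2 * real n) (\<Sum>v\<in>hst_leaves b i. 1 + X \<omega> i v))
        \<le> measure_pmf.expectation (sample_pair L [] n) (\<lambda>\<omega>. 2 * real n)"
      by (intro integral_mono int) simp
    moreover have "measure_pmf.expectation (sample_pair L [] n) (\<lambda>\<omega>. min (2 * real n) (\<Sum>v\<in>hst_leaves b i. 1 + X \<omega> i v))
        \<le> measure_pmf.expectation (sample_pair L [] n) (\<lambda>\<omega>. \<Sum>v\<in>hst_leaves b i. 1 + X \<omega> i v)"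
      by (intro integral_mono int) simp
    ultimately show "measure_pmf.expectation (sample_pair L [] n) (\<lambda>\<omega>. min (2 * real n) (\<Sum>v\<in>hst_leaves b i. 1 + X \<omega> i v))
        \<le> min (2 * real n) (\<Sum>v\<in>hst_leaves b i. 1 + D i v)"
      by (simp add: int D_def X_def)
  qed (use lam in auto)
  finally show "expected_opt_tour_cost b \<delta> lam n \<le>
      2 * (\<Sum>i\<in>{1..\<delta>}. lam ^ i * min (2 * real n) (\<Sum>v\<in>hst_leaves b i. 1 + D i v))" .
qed

text \<open>With \<open>c = b ^ i\<close> vertices on the level, each imbalance has mean of order
  \<open>t = sqrt (real n / c)\<close>, and \<open>c * t\<close> is the claimed quantity. The
  condition \<open>b ^ i \<le> n\<close> gives \<open>t \<ge> 1\<close>, which both makes the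
  variance at least 1 for the lower bound and absorbs the summand 1 in the upper bound.\<close>

lemma level_imbalance_bounds:
  fixes b i \<delta> n :: nat
  assumes b: "b \<ge> 2" and i: "1 \<le> i" "i \<le> \<delta>" "b ^ i \<le> n"
  defines "D \<equiv> \<lambda>v. measure_pmf.expectation (sample_pair (pmf_of_set (hst_leaves b \<delta>)) [] n)
    (\<lambda>\<omega>. \<bar>count_diff (\<lambda>x. take i x = v) n \<omega>\<bar>)"
  shows "3 / 8 * (sqrt (real n) * sqrt (real b) ^ i) \<le> (\<Sum>v\<in>hst_leaves b i. D v)"
    and "(\<Sum>v\<in>hst_leaves b i. 1 + D v) \<le> 5 / 2 * (sqrt (real n) * sqrt (real b) ^ i)"
proof -
  define c where "c = real (b ^ i)"
  define t where "t = sqrt (real n / c)"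
  have "b ^ 1 \<le> b ^ i" using b i by (intro power_increasing) auto
  then have "2 \<le> b ^ i" using b by simp
  then have "real 2 \<le> c" "c \<le> real n" using i(3) unfolding c_def of_nat_le_iff .
  then have c: "c \<ge> 2" "c \<le> real n" by simp_all
  then have t: "t \<ge> 1" "t\<^sup>2 = real n / c" by (auto simp: t_def)
  have "sqrt c * sqrt c = c" "sqrt c * t = sqrt (real n)"
    using c by (simp_all add: t_def flip: real_sqrt_mult)
  then have "c * t = sqrt (real n) * sqrt c" by (metis mult.assoc mult.commute)
  then have ct: "c * t = sqrt (real n) * sqrt (real b) ^ i"
    by (simp add: c_def real_sqrt_power)
  have fin: "finite (set_pmf (pmf_of_set (hst_leaves b \<delta>)))"
  proof -
    have "hst_leaves b \<delta> \<noteq> {}" using card_hst_leaves(2)[of b \<delta>] b by auto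
    then show ?thesis by (simp add: card_hst_leaves)
  qed
  define V where "V = real n * (2 * (1 / c) * (1 - 1 / c))"
  have V_eq: "V = t\<^sup>2 * (2 - 2 / c)" by (simp add: V_def t(2) field_simps)
  \<comment> \<open>As \<open>c\<close> is at least 2, the factor \<open>2 - 2 / c\<close> lies
    between 1 and 2.\<close>
  have V: "t\<^sup>2 \<le> V" "V \<le> 2 * t\<^sup>2"
    using c mult_left_mono[of 1 "2 - 2 / c" "t\<^sup>2"] mult_left_mono[of "2 - 2 / c" 2 "t\<^sup>2"]
    by (simp_all add: V_eq field_simps)
  have prob: "measure_pmf.prob (pmf_of_set (hst_leaves b \<delta>)) {x. take i x = v} = 1 / c"
    if "v \<in> hst_leaves b i" for v
    using prob_leaf_below[of b i \<delta> v] that b i by (simp add: c_def)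
  have D: "3 / 8 * t \<le> D v" "D v \<le> 3 / 2 * t" if v: "v \<in> hst_leaves b i" for v
  proof -
    have "1 \<le> V" using V t by (smt (verit) one_le_power)
    then have "3 / 8 * sqrt V \<le> D v"
      using expectation_abs_count_diff_ge[OF fin, of n "\<lambda>x. take i x = v" "[]"]
      by (simp add: prob[OF v] D_def V_def)
    moreover have "t \<le> sqrt V" using V(1) t by (intro real_le_rsqrt) auto
    ultimately show "3 / 8 * t \<le> D v" by linarith
    have "D v \<le> (V / t + t) / 2"
      using expectation_abs_count_diff_le[OF fin, of t "[]" n "\<lambda>x. take i x = v"] t
      by (simp add: prob[OF v] D_def V_def)
    moreover have "V / t \<le> 2 * t" using V(2) t by (simp add: field_simps power2_eq_square)
    ultimately show "D v \<le> 3 / 2 * t" by simp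
  qed
  have "(\<Sum>v\<in>hst_leaves b i. 3 / 8 * t) \<le> (\<Sum>v\<in>hst_leaves b i. D v)"
    by (intro sum_mono D)
  then show "3 / 8 * (sqrt (real n) * sqrt (real b) ^ i) \<le> (\<Sum>v\<in>hst_leaves b i. D v)"
    unfolding ct[symmetric] by (simp add: card_hst_leaves c_def)
  have "(\<Sum>v\<in>hst_leaves b i. 1 + D v) \<le> (\<Sum>v\<in>hst_leaves b i. 5 / 2 * t)"
    using D(2) t(1) by (intro sum_mono) force
  then show "(\<Sum>v\<in>hst_leaves b i. 1 + D v) \<le> 5 / 2 * (sqrt (real n) * sqrt (real b) ^ i)"
    unfolding ct[symmetric] by (simp add: card_hst_leaves c_def)
qed

section \<open>Summation over the levels\<close>

lemma sum_power_tail_le: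
  fixes x :: real
  assumes "0 \<le> x" "x < 1"
  shows "(\<Sum>i\<in>{m..d}. x ^ i) \<le> x ^ m / (1 - x)"
proof -
  have "(\<Sum>i\<in>{m..d}. x ^ i) = x ^ m * (\<Sum>i<Suc d - m. x ^ i)"
    by (cases "m \<le> Suc d")
      (auto simp: sum_distrib_left power_add[symmetric] intro!: sum.reindex_bij_witness[of _ "\<lambda>i. m + i" "\<lambda>i. i - m"])
  also have "\<dots> \<le> x ^ m * (1 / (1 - x))"
    using assms by (intro mult_left_mono) (auto simp: sum_gp_strict intro!: divide_right_mono)
  finally show ?thesis by simp
qed

text \<open>The constants are chosen before \<open>\<delta>\<close> and \<open>n\<close>, hence
  depend on \<open>b\<close> and \<open>lam\<close> only. The range \<open>n \<ge> b\<close> makes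
  level 1 part of the sum; for \<open>n\<close> between 1 and \<open>b - 1\<close> the sum is empty
  although the expected cost is positive.\<close>

theorem theorem9:
  fixes b :: nat and lam :: real
  assumes "b \<ge> 2" and "0 < lam" and "lam < 1"
  shows "\<exists>c>0. \<exists>C>0. \<forall>\<delta>\<ge>1. \<forall>n\<ge>b.
    (let h = min (real \<delta>) (log (real b) (real n));
         f = sqrt (real n) * (\<Sum>i | 1 \<le> i \<and> real i \<le> h. (sqrt (real b) * lam) ^ i)
     in c * f \<le> expected_opt_tour_cost b \<delta> lam n \<and>
        expected_opt_tour_cost b \<delta> lam n \<le> C * f)"
proof -
  \<comment> \<open>Both terms carry the factor 2 of the cost formula: \<open>5 / 2\<close> comes
    from the shallow levels, \<open>2 * sqrt (real b) / (1 - lam)\<close> from the deep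
    ones.\<close>
  define C where "C = 5 + 4 * sqrt (real b) / (1 - lam)"
  have "C > 0" using assms by (auto simp: C_def intro!: add_pos_nonneg)
  have main: "3 / 4 * f \<le> expected_opt_tour_cost b \<delta> lam n \<and> expected_opt_tour_cost b \<delta> lam n \<le> C * f"
    if \<delta>: "\<delta> \<ge> 1" and n: "n \<ge> b" and f: "f = sqrt (real n) *
      (\<Sum>i | 1 \<le> i \<and> real i \<le> min (real \<delta>) (log (real b) (real n)). (sqrt (real b) * lam) ^ i)"
    for \<delta> n f
  proof -
    \<comment> \<open>The shallow levels, those with at most \<open>n\<close> vertices.\<close>
    define I where "I = {i\<in>{1..\<delta>}. b ^ i \<le> n}"
    have "real i \<le> log (real b) (real n) \<longleftrightarrow> b ^ i \<le> n" for i
    proof -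
      have "real i \<le> log (real b) (real n) \<longleftrightarrow> real b powr real i \<le> real n"
        using assms n by (intro le_log_iff) auto
      also have "\<dots> \<longleftrightarrow> b ^ i \<le> n"
        using assms by (simp add: powr_realpow flip: of_nat_power)
      finally show ?thesis .
    qed
    then have I: "{i. 1 \<le> i \<and> real i \<le> min (real \<delta>) (log (real b) (real n))} = I"
      by (auto simp: I_def)
    define w where "w i = sqrt (real n) * sqrt (real b) ^ i" for i
    have f: "f = (\<Sum>i\<in>I. lam ^ i * w i)"
      unfolding f I by (simp add: w_def sum_distrib_left power_mult_distrib mult_ac)
    have fin_I: "finite I" and I_sub: "I \<subseteq> {1..\<delta>}" by (auto simp: I_def)
    have w_nonneg: "w i \<ge> 0" for i by (simp add: w_def)
    define D where "D i v = measure_pmf.expectation (sample_pair (pmf_of_set (hst_leaves b \<delta>)) [] n)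
      (\<lambda>\<omega>. \<bar>count_diff (\<lambda>x. take i x = v) n \<omega>\<bar>)" for i v
    have D_nonneg: "D i v \<ge> 0" for i v by (simp add: D_def)
    have bounds: "2 * (\<Sum>i\<in>{1..\<delta>}. lam ^ i * (\<Sum>v\<in>hst_leaves b i. D i v)) \<le> expected_opt_tour_cost b \<delta> lam n"
      "expected_opt_tour_cost b \<delta> lam n \<le>
        2 * (\<Sum>i\<in>{1..\<delta>}. lam ^ i * min (2 * real n) (\<Sum>v\<in>hst_leaves b i. 1 + D i v))"
      using expected_opt_tour_cost_bounds[of b n lam \<delta>] assms n by (simp_all add: D_def)
    have level: "3 / 8 * w i \<le> (\<Sum>v\<in>hst_leaves b i. D i v)"
      "(\<Sum>v\<in>hst_leaves b i. 1 + D i v) \<le> 5 / 2 * w i" if "i \<in> I" for i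
      using level_imbalance_bounds[of b i \<delta> n] that assms by (simp_all add: I_def D_def w_def)
    have "3 / 4 * f = 2 * (\<Sum>i\<in>I. lam ^ i * (3 / 8 * w i))"
      by (simp add: f sum_distrib_left mult_ac)
    also have "\<dots> \<le> 2 * (\<Sum>i\<in>I. lam ^ i * (\<Sum>v\<in>hst_leaves b i. D i v))"
      using assms level(1) by (intro mult_left_mono sum_mono) auto
    also have "\<dots> \<le> 2 * (\<Sum>i\<in>{1..\<delta>}. lam ^ i * (\<Sum>v\<in>hst_leaves b i. D i v))"
      using assms I_sub D_nonneg by (intro mult_left_mono sum_mono2) (auto intro!: mult_nonneg_nonneg sum_nonneg)
    finally have lower: "3 / 4 * f \<le> expected_opt_tour_cost b \<delta> lam n"
      using bounds(1) by linarith

    \<comment> \<open>On deep levels the cap \<open>2 * real n\<close> leaves a geometric series,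
      which is compared with the single term of \<open>f\<close> at the last shallow level
      \<open>H\<close>.\<close>
    have deep: "(\<Sum>i\<in>{1..\<delta>} - I. lam ^ i * (2 * real n)) \<le> 2 * sqrt (real b) / (1 - lam) * f"
    proof (cases "{1..\<delta>} - I = {}")
      case True
      have "f \<ge> 0" unfolding f using assms w_nonneg by (intro sum_nonneg) auto
      then show ?thesis unfolding True using assms by simp
    next
      case False
      have "1 \<in> I" using \<delta> n by (simp add: I_def)
      define H where "H = Max I"
      have H: "H \<in> I" unfolding H_def using \<open>1 \<in> I\<close> fin_I by (intro Max_in) auto
      have H_max: "i \<le> H" if "i \<in> I" for i unfolding H_def using that fin_I by simp
      have tail: "Suc H \<le> i" if "i \<in> {1..\<delta>} - I" for i
      proof (rule ccontr)
        assume "\<not> Suc H \<le> i"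
        then have "b ^ i \<le> b ^ H" using assms by (intro power_increasing) auto
        with H that show False by (auto simp: I_def)
      qed
      have "Suc H \<notin> I" using H_max[of "Suc H"] by auto
      moreover have "Suc H \<in> {1..\<delta>}" using False tail by fastforce
      \<comment> \<open>Level \<open>Suc H\<close> exists in the tree and is not shallow, so only
        the size condition can fail there.\<close>
      ultimately have "n < b ^ Suc H" by (auto simp: I_def)
      then have "real n \<le> real b ^ Suc H" by (metis less_imp_le of_nat_le_iff of_nat_power)
      then have "sqrt (real n) \<le> sqrt (real b) ^ Suc H"
        by (metis real_sqrt_le_iff real_sqrt_power)
      then have "sqrt (real n) * sqrt (real n) \<le> sqrt (real n) * sqrt (real b) ^ Suc H"
        by (intro mult_left_mono) auto
      \<comment> \<open>Going one level past \<open>H\<close> costs just a factor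
        \<open>sqrt (real b)\<close>.\<close>
      then have n_le: "real n \<le> sqrt (real b) * w H" by (simp add: w_def mult_ac)
      have "(\<Sum>i\<in>{1..\<delta>} - I. lam ^ i * (2 * real n)) \<le> (\<Sum>i\<in>{Suc H..\<delta>}. lam ^ i * (2 * real n))"
        using tail assms by (intro sum_mono2) auto
      also have "\<dots> = (\<Sum>i\<in>{Suc H..\<delta>}. lam ^ i) * (2 * real n)"
        by (simp add: sum_distrib_right)
      also have "\<dots> \<le> lam ^ Suc H / (1 - lam) * (2 * real n)"
        using assms by (intro mult_right_mono sum_power_tail_le) auto
      also have "\<dots> \<le> lam ^ H / (1 - lam) * (2 * (sqrt (real b) * w H))"
        using assms n_le by (intro mult_mono divide_right_mono) (auto simp: mult_left_le_one_le)
      also have "\<dots> = 2 * sqrt (real b) / (1 - lam) * (lam ^ H * w H)" by simp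
      also have "\<dots> \<le> 2 * sqrt (real b) / (1 - lam) * f"
        unfolding f using assms w_nonneg H fin_I
        by (intro mult_left_mono member_le_sum[where f = "\<lambda>i. lam ^ i * w i"]) auto
      finally show ?thesis .
    qed
    have shallow: "(\<Sum>i\<in>I. lam ^ i * (5 / 2 * w i)) = 5 / 2 * f"
      by (simp add: f sum_distrib_left mult_ac)
    \<comment> \<open>The minimum is bounded by its second argument on shallow levels and by its
      first on deep ones.\<close>
    have "(\<Sum>i\<in>{1..\<delta>}. lam ^ i * min (2 * real n) (\<Sum>v\<in>hst_leaves b i. 1 + D i v))
        \<le> (\<Sum>i\<in>I. lam ^ i * (5 / 2 * w i)) + (\<Sum>i\<in>{1..\<delta>} - I. lam ^ i * (2 * real n))"
      unfolding sum.subset_diff[OF I_sub finite_atLeastAtMost] add.commute[of "sum _ ({1..\<delta>} - I)"]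
      using assms min.coboundedI2[OF level(2)] by (intro add_mono sum_mono mult_left_mono) auto
    also have "\<dots> \<le> 5 / 2 * f + 2 * sqrt (real b) / (1 - lam) * f"
      unfolding shallow using deep by (rule add_left_mono)
    finally have "expected_opt_tour_cost b \<delta> lam n \<le> 2 * (5 / 2 * f + 2 * sqrt (real b) / (1 - lam) * f)"
      by (intro order_trans[OF bounds(2)] mult_left_mono) simp_all
    also have "\<dots> = C * f" by (simp add: C_def algebra_simps)
    finally show ?thesis using lower by blast
  qed
  show ?thesis
    unfolding Let_def
    by (intro exI[of _ "3 / 4"] exI[of _ C] conjI allI impI) (use main \<open>C > 0\<close> in auto)
qed

end
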